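(* Let $a,b\in\mathbb{R}$. For each $n$ let $X_1,\dots,X_n$ (whose common distribution may depend on $n$) be identically distributed, Boolean independent random variables with mean $\varphi(X_i)=\frac{1}{\sqrt n}$ and variance $1$. Then the sequence of quadratic forms $$Q_n=\frac1n\sum_{\substack{k,j=1\\ k<j}}^n\Big(a(X_kX_j+X_jX_k)+ib(X_kX_j-X_jX_k)\Big)$$ (where $i$ is the imaginary unit) converges in distribution as $n\to\infty$ to some $Y$, where the $H$-transform of the limit distribution is $$H_Y(z)=\frac1z\,\frac{\tan(bz)}{b-a\tan(bz)}-1 .$$
   Context: A noncommutative probability space is a pair $(\mathcal A,\varphi)$ with $\mathcal A$ a unital $*$-algebra and $\varphi:\mathcal A\to\mathbb C$ a normal state; random variables are self-adjoint elements of $\mathcal A$. Subalgebras $(\mathcal A_i)_{i\in I}$ are Boolean independent if $\varphi(X_1\cdots X_m)=\varphi(X_1)\cdots\varphi(X_m)$ whenever $X_j\in\mathcal A_{i(j)}$ with $i(1)\ne i(2)\ne\dots\ne i(m)$ (consecutive indices distinct); random variables are Boolean independent if the (not necessarily unital) subalgebras they generate are. $\mathcal I(n)$ is the set of interval partitions of $\{1,\dots,n\}$ (every block consists of consecutive integers). The Boolean cumulants are the multilinear functionals $K_n:\mathcal A^n\to\mathbb C$ defined recursively by $\varphi(X_1\cdots X_n)=\sum_{\pi\in\mathcal I(n)}K_\pi(X_1,\dots,X_n)$, where $K_\pi(X_1,\dots,X_n)=\prod_{B\in\pi}K_{|B|}(X_i:i\in B)$; write $K_n(X)=K_n(X,\dots,X)$.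 The mean is $K_1(X)=\varphi(X)$ and the variance is $K_2(X)=\varphi(X^2)-\varphi(X)^2$. The $H$-transform is $H_X(z)=\sum_{n\ge1}K_n(X)z^n$ near $0$. "Identically distributed" means: $K_r(X_1)=\dots=K_r(X_n)$ for all $r\in\mathbb N$ (these values may depend on $n$), and $|K_r(X_i)|<C_r$ with constants $C_r$ independent of $n$. Convergence in distribution $X_n\to X$ means $\lim_n\varphi(X_n^m)=\varphi(X^m)$ for all $m\in\mathbb N$, equivalently $\lim_nK_m(X_n)=K_m(X)$ for all $m$. Where the formula for $H_Y$ reads $0/0$ it is understood as the limiting value. *)

theory Defs
  imports
    "HOL-Analysis.Analysis"
    "HOL-Library.Disjoint_Sets"
    "HOL-Computational_Algebra.Polynomial"
begin

section \<open>Noncommutative probability spaces\<close>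

locale star_algebra = vector_space cscale
  for cscale :: "complex \<Rightarrow> 'a::ring_1 \<Rightarrow> 'a" +
  fixes star :: "'a \<Rightarrow> 'a"
  assumes cscale_mult_left: "cscale c x * y = cscale c (x * y)"
    and cscale_mult_right: "x * cscale c y = cscale c (x * y)"
    and star_star: "star (star x) = x"
    and star_add: "star (x + y) = star x + star y"
    and star_cscale: "star (cscale c x) = cscale (cnj c) (star x)"
    and star_mult: "star (x * y) = star y * star x"

text \<open>On a bare *-algebra, a normal state is read as a normalized positive linear functional.\<close>

locale nc_prob_space = star_algebra cscale star
  for cscale :: "complex \<Rightarrow> 'a::ring_1 \<Rightarrow> 'a" and star :: "'a \<Rightarrow> 'a" +
  fixes \<phi> :: "'a \<Rightarrow> complex"
  assumes state_linear: "Vector_Spaces.linear cscale (*) \<phi>"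
    and state_positive: "\<phi> (star x * x) \<in> \<real>\<^sub>\<ge>\<^sub>0"
    and state_one: "\<phi> 1 = 1"

section \<open>Boolean independence\<close>

text \<open>Subalgebras need not contain the unit.\<close>

definition is_subalgebra :: "(complex \<Rightarrow> 'a::ring_1 \<Rightarrow> 'a) \<Rightarrow> 'a set \<Rightarrow> bool" where
  "is_subalgebra cscale B \<longleftrightarrow>
     module.subspace cscale B \<and> (\<forall>x\<in>B. \<forall>y\<in>B. x * y \<in> B)"

definition generated_subalgebra :: "(complex \<Rightarrow> 'a::ring_1 \<Rightarrow> 'a) \<Rightarrow> 'a set \<Rightarrow> 'a set" where
  "generated_subalgebra cscale S = is_subalgebra cscale hull S"

text \<open>A word \<open>X\<^sub>1 \<cdots> X\<^sub>m\<close> with \<open>X\<^sub>j \<in> A (i j)\<close> is encoded as the list of pairs \<open>(i j, X\<^sub>j)\<close>.\<close>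

definition boolean_independent_subalgebras ::
    "('a::ring_1 \<Rightarrow> complex) \<Rightarrow> 'i set \<Rightarrow> ('i \<Rightarrow> 'a set) \<Rightarrow> bool" where
  "boolean_independent_subalgebras \<phi> I A \<longleftrightarrow>
     (\<forall>w. w \<noteq> [] \<and> (\<forall>(i, x) \<in> set w. i \<in> I \<and> x \<in> A i) \<and> distinct_adj (map fst w) \<longrightarrow>
        \<phi> (prod_list (map snd w)) = prod_list (map (\<lambda>(i, x). \<phi> x) w))"

definition boolean_independent ::
    "(complex \<Rightarrow> 'a::ring_1 \<Rightarrow> 'a) \<Rightarrow> ('a \<Rightarrow> complex) \<Rightarrow> 'i set \<Rightarrow> ('i \<Rightarrow> 'a) \<Rightarrow> bool" where
  "boolean_independent cscale \<phi> I X \<longleftrightarrow>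
     boolean_independent_subalgebras \<phi> I (\<lambda>i. generated_subalgebra cscale {X i})"

section \<open>Boolean cumulants\<close>

text \<open>Positions in a word of length \<open>n\<close> are counted from \<open>0\<close>.\<close>

definition interval_partitions :: "nat \<Rightarrow> nat set set set" where
  "interval_partitions n =
     {\<pi>. partition_on {..<n} \<pi> \<and> (\<forall>B\<in>\<pi>. \<exists>i j. B = {i..j})}"

lemma finite_interval_partitions: "finite (interval_partitions n)"
  by (rule finite_subset[of _ "Pow (Pow {..<n})"])
     (auto simp: interval_partitions_def partition_on_def)

lemma trivial_interval_partition:
  assumes "n > 0"
  shows "{{..<n}} \<in> interval_partitions n"
proof -
  have "{..<n} = {0..n - 1}" using assms by auto
  thus ?thesis using assms
    by (auto simp: interval_partitions_def partition_on_def disjoint_def)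
qed

lemma interval_partition_block_smaller:
  assumes "\<pi> \<in> interval_partitions (length xs) - {{{..<length xs}}}" "B \<in> \<pi>"
  shows "length (nths xs B) < length xs"
proof -
  have p: "partition_on {..<length xs} \<pi>" and ne: "\<pi> \<noteq> {{..<length xs}}"
    using assms by (auto simp: interval_partitions_def)
  have sub: "B \<subseteq> {..<length xs}" using p assms(2) by (auto simp: partition_on_def)
  have "B \<noteq> {..<length xs}"
  proof
    assume B: "B = {..<length xs}"
    have "C = B" if C: "C \<in> \<pi>" for C
    proof (rule ccontr)
      assume "C \<noteq> B"
      then have "C \<inter> B = {}"
        using p C assms(2) by (auto simp: partition_on_def disjoint_def)
      moreover have "C \<subseteq> B" using p C B by (auto simp: partition_on_def)
      moreover have "C \<noteq> {}" using p C by (auto simp: partition_on_def)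
      ultimately show False by blast
    qed
    then have "\<pi> = {B}" using assms(2) by blast
    with ne B show False by simp
  qed
  with sub have "B \<subset> {..<length xs}" by blast
  then have "card B < length xs"
    using psubset_card_mono[of "{..<length xs}" B] by simp
  moreover have "{i. i < length xs \<and> i \<in> B} = B" using sub by auto
  ultimately show ?thesis by (simp add: length_nths)
qed

text \<open>\<open>boolean_cumulant \<phi> [X\<^sub>1, \<dots>, X\<^sub>n]\<close> is \<open>K\<^sub>n(X\<^sub>1, \<dots>, X\<^sub>n)\<close>: the moment-cumulant
  formula below, solved for the term of the one-block partition.\<close>

function boolean_cumulant :: "('a::monoid_mult \<Rightarrow> complex) \<Rightarrow> 'a list \<Rightarrow> complex" where
  "boolean_cumulant \<phi> xs = \<phi> (prod_list xs) -
     (\<Sum>\<pi>\<in>interval_partitions (length xs) - {{{..<length xs}}}.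
        \<Prod>B\<in>\<pi>. boolean_cumulant \<phi> (nths xs B))"
  by pat_completeness auto
termination
proof (relation "Wellfounded.measure (\<lambda>(\<phi>, xs). length xs)")
  fix \<phi> :: "'a \<Rightarrow> complex" and xs :: "'a list" and \<pi> B
  assume "\<pi> \<in> interval_partitions (length xs) - {{{..<length xs}}}" "B \<in> \<pi>"
  from interval_partition_block_smaller[OF this]
  show "((\<phi>, nths xs B), (\<phi>, xs)) \<in> Wellfounded.measure (\<lambda>(\<phi>, xs). length xs)"
    by simp
qed simp

declare boolean_cumulant.simps [simp del]

lemma moment_boolean_cumulant:
  assumes "xs \<noteq> []"
  shows "\<phi> (prod_list xs) =
    (\<Sum>\<pi>\<in>interval_partitions (length xs). \<Prod>B\<in>\<pi>. boolean_cumulant \<phi> (nths xs B))"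
proof -
  let ?K = "\<lambda>\<pi>. \<Prod>B\<in>\<pi>. boolean_cumulant \<phi> (nths xs B)"
  have "{{..<length xs}} \<in> interval_partitions (length xs)"
    using assms by (intro trivial_interval_partition) simp
  then have "sum ?K (interval_partitions (length xs)) =
      ?K {{..<length xs}} + sum ?K (interval_partitions (length xs) - {{{..<length xs}}})"
    by (rule sum.remove[OF finite_interval_partitions])
  moreover have "?K {{..<length xs}} = boolean_cumulant \<phi> xs"
    by (simp add: nths_all)
  moreover have "boolean_cumulant \<phi> xs = \<phi> (prod_list xs) -
      sum ?K (interval_partitions (length xs) - {{{..<length xs}}})"
    by (rule boolean_cumulant.simps)
  ultimately show ?thesis by simp
qed

abbreviation boolean_cumulant_var :: "('a::monoid_mult \<Rightarrow> complex) \<Rightarrow> nat \<Rightarrow> 'a \<Rightarrow> complex" where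
  "boolean_cumulant_var \<phi> r x \<equiv> boolean_cumulant \<phi> (replicate r x)"

text \<open>\<open>H\<close> is the \<open>H\<close>-transform of \<open>x\<close> as a germ at \<open>0\<close>; convergence of the series near \<open>0\<close>
  is part of the claim.\<close>

definition has_H_transform ::
    "('a::monoid_mult \<Rightarrow> complex) \<Rightarrow> 'a \<Rightarrow> (complex \<Rightarrow> complex) \<Rightarrow> bool" where
  "has_H_transform \<phi> x H \<longleftrightarrow>
     (\<forall>\<^sub>F z in nhds 0. (\<lambda>m. boolean_cumulant_var \<phi> (Suc m) x * z ^ Suc m) sums H z)"

section \<open>Triangular arrays and convergence in distribution\<close>

definition variance_of :: "('a::monoid_mult \<Rightarrow> complex) \<Rightarrow> 'a \<Rightarrow> complex" where
  "variance_of \<phi> x = \<phi> (x ^ 2) - (\<phi> x) ^ 2"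

text \<open>The \<open>n\<close>-th row is \<open>X n 1, \<dots>, X n n\<close>. The constants \<open>C r\<close> do not depend on the row.\<close>

definition identically_distributed ::
    "(nat \<Rightarrow> 'a::monoid_mult \<Rightarrow> complex) \<Rightarrow> (nat \<Rightarrow> nat \<Rightarrow> 'a) \<Rightarrow> bool" where
  "identically_distributed \<phi> X \<longleftrightarrow>
     (\<forall>n. \<forall>i\<in>{1..n}. \<forall>j\<in>{1..n}. \<forall>r\<ge>1.
        boolean_cumulant_var (\<phi> n) r (X n i) = boolean_cumulant_var (\<phi> n) r (X n j)) \<and>
     (\<exists>C :: nat \<Rightarrow> real. \<forall>n. \<forall>i\<in>{1..n}. \<forall>r\<ge>1.
        cmod (boolean_cumulant_var (\<phi> n) r (X n i)) < C r)"

text \<open>The approximating variables and the limit may live in different spaces. The limit is sought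
  in a space on the type \<^typ>\<open>complex poly\<close>: HOL has no quantifier over types, and the law of any
  single self-adjoint variable is realized there, by evaluating polynomials at that variable.\<close>

definition converges_in_distribution ::
    "(nat \<Rightarrow> 'a::monoid_mult \<Rightarrow> complex) \<Rightarrow> (nat \<Rightarrow> 'a) \<Rightarrow>
     ('b::monoid_mult \<Rightarrow> complex) \<Rightarrow> 'b \<Rightarrow> bool" where
  "converges_in_distribution \<phi> Q \<psi> Y \<longleftrightarrow>
     (\<forall>m. (\<lambda>n. \<phi> n (Q n ^ m)) \<longlonglongrightarrow> \<psi> (Y ^ m))"

section \<open>The quadratic forms and the transform of their limit\<close>

definition quadratic_form ::
    "(complex \<Rightarrow> 'a::ring_1 \<Rightarrow> 'a) \<Rightarrow> real \<Rightarrow> real \<Rightarrow> nat \<Rightarrow> (nat \<Rightarrow> 'a) \<Rightarrow> 'a" where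
  "quadratic_form cscale a b n x =
     cscale (1 / of_nat n)
       (\<Sum>(k, j)\<in>{(k, j). 1 \<le> k \<and> k < j \<and> j \<le> n}.
          cscale (of_real a) (x k * x j + x j * x k) +
          cscale (\<i> * of_real b) (x k * x j - x j * x k))"

definition tan_formula :: "real \<Rightarrow> real \<Rightarrow> complex \<Rightarrow> complex" where
  "tan_formula a b z =
     1 / z * (tan (of_real b * z) / (of_real b - of_real a * tan (of_real b * z))) - 1"

text \<open>For \<open>b = 0\<close> or \<open>z = 0\<close> the formula reads \<open>0/0\<close> and stands for its limiting value,
  computed in the two lemmas below.\<close>

definition limit_H :: "real \<Rightarrow> real \<Rightarrow> complex \<Rightarrow> complex" where
  "limit_H a b z =
     (if b \<noteq> 0 \<and> z \<noteq> 0 then tan_formula a b z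
      else Lim (at (b, z) within {(b', z'). b' \<noteq> 0 \<and> z' \<noteq> 0})
             (\<lambda>(b', z'). tan_formula a b' z'))"

lemma tan_formula_tendsto:
  assumes "b = 0 \<or> z = 0" "of_real a * z \<noteq> 1"
  shows "((\<lambda>(b', z'). tan_formula a b' z') \<longlongrightarrow> 1 / (1 - of_real a * z) - 1)
           (at (b, z) within {(b', z'). b' \<noteq> 0 \<and> z' \<noteq> 0})"
proof -
  define F where "F = at (b, z) within {(b' :: real, z' :: complex). b' \<noteq> 0 \<and> z' \<noteq> 0}"
  define T where "T w = (if w = 0 then 1 else tan w / w)" for w :: complex
  have "((\<lambda>w. tan w / w) \<longlongrightarrow> 1) (at (0::complex))"
    using DERIV_tan[of "0::complex"] by (simp add: has_field_derivative_iff)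
  then have "(T \<longlongrightarrow> 1) (at 0)"
    by (rule Lim_transform_eventually) (auto simp: T_def eventually_at_filter)
  then have contT: "isCont T 0" by (simp add: isCont_def T_def)
  have "((\<lambda>p. p) \<longlongrightarrow> (b, z)) F"
    unfolding F_def by (rule tendsto_ident_at)
  note id = tendsto_fst[OF this] tendsto_snd[OF this]
  have fst: "((\<lambda>p. complex_of_real (fst p)) \<longlongrightarrow> of_real b) F"
    using tendsto_of_real[OF id(1)] by simp
  have snd: "((\<lambda>p. snd p) \<longlongrightarrow> z) F"
    using id(2) by simp
  have "((\<lambda>p. of_real (fst p) * snd p) \<longlongrightarrow> (0::complex)) F"
    using tendsto_mult[OF fst snd] assms(1) by (elim disjE) simp_all
  from isCont_tendsto_compose[OF contT this]
  have T: "((\<lambda>p. T (of_real (fst p) * snd p)) \<longlongrightarrow> 1) F" by (simp add: T_def)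
  have "((\<lambda>p. T (of_real (fst p) * snd p) /
           (1 - of_real a * snd p * T (of_real (fst p) * snd p)) - 1)
          \<longlongrightarrow> 1 / (1 - of_real a * z * 1) - 1) F"
    using assms(2) by (intro tendsto_intros T snd) auto
  then have "((\<lambda>(b', z'). tan_formula a b' z') \<longlongrightarrow> 1 / (1 - of_real a * z * 1) - 1) F"
  proof (rule Lim_transform_eventually)
    have eq: "t / (\<beta> * w) / (1 - \<alpha> * w * (t / (\<beta> * w))) = 1 / w * (t / (\<beta> - \<alpha> * t))"
      if "\<beta> \<noteq> 0" "w \<noteq> 0" for t \<alpha> \<beta> w :: complex
    proof -
      have "1 - \<alpha> * w * (t / (\<beta> * w)) = (\<beta> - \<alpha> * t) / \<beta>"
        using that by (simp add: diff_divide_distrib)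
      then show ?thesis using that by simp
    qed
    show "\<forall>\<^sub>F p in F. T (of_real (fst p) * snd p) /
        (1 - of_real a * snd p * T (of_real (fst p) * snd p)) - 1 =
        (case p of (b', z') \<Rightarrow> tan_formula a b' z')"
      unfolding F_def eventually_at_filter
    proof (rule always_eventually, intro allI impI)
      fix p :: "real \<times> complex"
      assume "p \<in> {(b', z'). b' \<noteq> 0 \<and> z' \<noteq> 0}"
      then have ne: "complex_of_real (fst p) \<noteq> 0" "snd p \<noteq> 0" by auto
      then have "T (of_real (fst p) * snd p) = tan (of_real (fst p) * snd p) / (of_real (fst p) * snd p)"
        by (simp add: T_def)
      then show "T (of_real (fst p) * snd p) /
        (1 - of_real a * snd p * T (of_real (fst p) * snd p)) - 1 =
        (case p of (b', z') \<Rightarrow> tan_formula a b' z')"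
        by (simp only: eq[OF ne] tan_formula_def case_prod_beta)
    qed
  qed
  then show ?thesis by (simp add: F_def)
qed

lemma limit_H_degenerate:
  assumes "b = 0 \<or> z = 0" "of_real a * z \<noteq> 1"
  shows "limit_H a b z = 1 / (1 - of_real a * z) - 1"
proof -
  have S: "{(b' :: real, z' :: complex). b' \<noteq> 0 \<and> z' \<noteq> 0} = (- {0}) \<times> (- {0})" by auto
  have "at (b, z) within {(b', z'). b' \<noteq> 0 \<and> z' \<noteq> 0} \<noteq> bot"
    using assms(1) unfolding S trivial_limit_within islimpt_in_closure
    by (auto simp: closure_Times closure_complement)
  from tendsto_Lim[OF this tan_formula_tendsto[OF assms]] show ?thesis
    using assms(1) by (auto simp: limit_H_def)
qed

end

theory Submission
  imports Defs "HOL-Analysis.FPS_Convergence"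
begin

text \<open>
  Write \<open>\<alpha> = a + ib\<close> and \<open>\<beta> = a - ib\<close>, so that \<open>Q\<^sub>n = \<Sum> c\<^sub>k\<^sub>l X\<^sub>k X\<^sub>l\<close> with \<open>c\<^sub>k\<^sub>l = \<alpha> / n\<close> above
  the diagonal, \<open>\<beta> / n\<close> below it and \<open>0\<close> on it. As the diagonal vanishes, equal neighbours in a word
  of \<open>Q\<^sub>n\<^sup>m\<close> occur only where two factors \<open>Q\<^sub>n\<close> meet, and at most two at a time. Boolean independence
  therefore expresses every moment of \<open>Q\<^sub>n\<close> through \<open>\<phi>(X\<^sub>i)\<^sup>2 = 1/n\<close> and \<open>\<phi>(X\<^sub>i\<^sup>2) = 1 + 1/n\<close> alone.
  In terms of the power series \<open>M = \<Sum> \<phi>(Q\<^sub>n\<^sup>m) z\<^sup>m\<close> and \<open>h\<^sub>i = \<surd>n \<Sum> \<phi>(X\<^sub>i Q\<^sub>n\<^sup>m) z\<^sup>m\<close> this is the finite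
  linear system \<open>h\<^sub>i = M + z \<Sum>\<^sub>l c\<^sub>i\<^sub>l h\<^sub>l\<close> and \<open>2 M = 1 + R\<close>, where \<open>R\<close> is the average of the \<open>h\<^sub>i\<close>
  (lemma \<open>moment_fps_system\<close>).

  The system is the discrete form of an integral equation whose kernel is constant on either
  side of the diagonal, and it telescopes to
  \<open>(M + \<alpha> z R) (1 + \<beta> z / n)\<^sup>n = (M + \<beta> z R) (1 + \<alpha> z / n)\<^sup>n\<close> (lemma \<open>triangular_system\<close>). With
  \<open>R = 2 M - 1\<close> this determines \<open>M\<close> as a quotient of power series, unless \<open>\<alpha> = \<beta>\<close>; in that case all
  \<open>h\<^sub>i\<close> coincide and \<open>M\<close> is found directly. The coefficients of \<open>(1 + c z / n)\<^sup>n\<close> tend to those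
  of \<open>exp (c z)\<close>, and so the moments converge (lemma \<open>moment_fps_tendsto\<close>) to the coefficients of
  the series \<open>M\<close> with \<open>M (2 - S) = 1\<close>, where
  \<open>S = (exp (\<alpha> z) - exp (\<beta> z)) / (z (\<alpha> exp (\<beta> z) - \<beta> exp (\<alpha> z)))\<close>, to be read as \<open>1 / (1 - a z)\<close> for
  \<open>b = 0\<close>.

  Removing the last block of an interval partition turns the moment-cumulant formula into
  \<open>M = 1 + H M\<close> (lemma \<open>moment_recursion\<close>). Hence the Boolean cumulants of the limit are the
  coefficients of \<open>H = S - 1\<close>, and Euler's formula rewrites \<open>S - 1\<close> as the expression with the
  tangent. Finally, the limit moments come from a state on the polynomials in one variable, since
  positivity passes to the limit (lemma \<open>state_of_limit_moments\<close>).
\<close>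

section \<open>Interval partitions and Boolean cumulants\<close>

lemma interval_partitions_0: "interval_partitions 0 = {{}}"
  by (auto simp: interval_partitions_def partition_on_def)

text \<open>Deleting the block that contains \<open>n - 1\<close> is a bijection onto the interval partitions of the
  initial segments \<open>{..<k}\<close> with \<open>k < n\<close>. It is the last block that is removed, not the first, because
  the remaining blocks then need no renumbering.\<close>

lemma sum_interval_partitions_last_block:
  fixes \<kappa> :: "nat \<Rightarrow> 'c::comm_semiring_1"
  assumes "n > 0"
  shows "(\<Sum>\<pi>\<in>interval_partitions n. \<Prod>B\<in>\<pi>. \<kappa> (card B)) =
         (\<Sum>k<n. \<kappa> (n - k) * (\<Sum>\<pi>\<in>interval_partitions k. \<Prod>B\<in>\<pi>. \<kappa> (card B)))"
proof -
  let ?f = "\<lambda>(k, \<rho>). insert {k..<n} \<rho>"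
  let ?w = "\<lambda>\<pi>. \<Prod>B\<in>\<pi>. \<kappa> (card B)"
  have sub: "B \<subseteq> {..<k}" "B \<noteq> {}" if "\<rho> \<in> interval_partitions k" "B \<in> \<rho>" for \<rho> k B
    using that by (auto simp: interval_partitions_def partition_on_def)
  have notin: "{k..<n} \<notin> \<rho>" if "\<rho> \<in> interval_partitions k" "k < n" for k \<rho>
    using sub[OF that(1), of "{k..<n}"] that(2) by force
  have bij: "bij_betw ?f (SIGMA k:{..<n}. interval_partitions k) (interval_partitions n)"
    unfolding bij_betw_def
  proof
    show "inj_on ?f (SIGMA k:{..<n}. interval_partitions k)"
    proof (rule inj_onI, unfold split_paired_all, clarsimp simp del: insert_iff)
      fix k \<rho> k' \<rho>'
      assume k: "k < n" "k' < n"
        and \<rho>: "\<rho> \<in> interval_partitions k" "\<rho>' \<in> interval_partitions k'"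
        and eq: "insert {k..<n} \<rho> = insert {k'..<n} \<rho>'"
      have last: "B = {k..<n}" if "B \<in> insert {k..<n} \<rho>" "n - 1 \<in> B" "\<rho> \<in> interval_partitions k"
        "k < n" for B k \<rho>
      proof (rule ccontr)
        assume "B \<noteq> {k..<n}"
        then have "B \<subseteq> {..<k}" using that(1) sub(1)[OF that(3)] by blast
        then show False using that(2,4) by auto
      qed
      have "n - 1 \<in> {k'..<n}" using k by auto
      then have "{k'..<n} = {k..<n}"
        using k(1) \<rho>(1) eq by (intro last[of _ k \<rho>]) auto
      then have "k' = k" using k by (auto simp: atLeastLessThan_eq_iff)
      moreover have "\<rho> = \<rho>'"
        using eq insert_ident[OF notin[OF \<rho>(1) k(1)], of \<rho>'] notin[OF \<rho>(2) k(2)] \<open>k' = k\<close>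
        by simp
      ultimately show "k = k' \<and> \<rho> = \<rho>'" by simp
    qed
    show "?f ` (SIGMA k:{..<n}. interval_partitions k) = interval_partitions n"
    proof
      show "?f ` (SIGMA k:{..<n}. interval_partitions k) \<subseteq> interval_partitions n"
      proof clarsimp
        fix k \<rho> assume k: "k < n" and \<rho>: "\<rho> \<in> interval_partitions k"
        have "partition_on {..<n} (insert {k..<n} \<rho>)"
          unfolding partition_on_def
        proof (intro conjI)
          have "\<Union>\<rho> = {..<k}" using \<rho> by (auto simp: interval_partitions_def partition_on_def)
          then show "\<Union>(insert {k..<n} \<rho>) = {..<n}" using k by auto
          have "disjoint \<rho>" using \<rho> by (auto simp: interval_partitions_def partition_on_def)
          moreover have "{k..<n} \<inter> B = {}" if "B \<in> \<rho>" for B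
            using sub[OF \<rho> that] by fastforce
          ultimately show "disjoint (insert {k..<n} \<rho>)"
            by (auto simp: disjoint_def)
          show "{} \<notin> insert {k..<n} \<rho>" using sub[OF \<rho>] k by auto
        qed
        moreover have "{k..<n} = {k..n - 1}" using k by auto
        ultimately show "insert {k..<n} \<rho> \<in> interval_partitions n"
          using \<rho> by (auto simp: interval_partitions_def)
      qed
      show "interval_partitions n \<subseteq> ?f ` (SIGMA k:{..<n}. interval_partitions k)"
      proof
        fix \<pi> assume \<pi>: "\<pi> \<in> interval_partitions n"
        then have un: "\<Union>\<pi> = {..<n}" and dis: "disjoint \<pi>" and ne: "{} \<notin> \<pi>"
          and iv: "\<And>B. B \<in> \<pi> \<Longrightarrow> \<exists>i j. B = {i..j}"
          by (auto simp: interval_partitions_def partition_on_def)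
        have "n - 1 \<in> \<Union>\<pi>" using un assms by auto
        then obtain B where B: "B \<in> \<pi>" "n - 1 \<in> B" by blast
        obtain i j where ij: "B = {i..j}" using iv[OF B(1)] by blast
        have "j \<in> B" using ij B(2) by auto
        then have "j < n" using un B by auto
        then have i: "i < n" and Bi: "B = {i..<n}" using ij B(2) assms by auto
        have "partition_on {..<i} (\<pi> - {B})"
          unfolding partition_on_def
        proof (intro conjI)
          have "C \<inter> B = {}" if "C \<in> \<pi> - {B}" for C
            using disjointD[OF dis, of C B] B(1) that by simp
          then have "\<Union>(\<pi> - {B}) = \<Union>\<pi> - B" by fast
          then show "\<Union>(\<pi> - {B}) = {..<i}" using un Bi i by auto
          show "disjoint (\<pi> - {B})" using dis by (auto simp: disjoint_def)
          show "{} \<notin> \<pi> - {B}" using ne by simp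
        qed
        then have "\<pi> - {B} \<in> interval_partitions i"
          using iv by (auto simp: interval_partitions_def)
        moreover have "\<pi> = ?f (i, \<pi> - {B})" using B Bi by auto
        ultimately show "\<pi> \<in> ?f ` (SIGMA k:{..<n}. interval_partitions k)"
          using i by blast
      qed
    qed
  qed
  have "(\<Sum>\<pi>\<in>interval_partitions n. ?w \<pi>) =
        (\<Sum>p\<in>(SIGMA k:{..<n}. interval_partitions k). ?w (?f p))"
    by (rule sum.reindex_bij_betw[OF bij, symmetric])
  also have "\<dots> = (\<Sum>(k, \<rho>)\<in>(SIGMA k:{..<n}. interval_partitions k). \<kappa> (n - k) * ?w \<rho>)"
  proof (rule sum.cong[OF refl], unfold split_paired_all, clarsimp)
    fix k \<rho> assume k: "k < n" and \<rho>: "\<rho> \<in> interval_partitions k"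
    have "finite \<rho>"
      using \<rho> by (auto simp: interval_partitions_def intro: finite_elements)
    then show "?w (insert {k..<n} \<rho>) = \<kappa> (n - k) * ?w \<rho>"
      using notin[OF \<rho>] k by simp
  qed
  also have "\<dots> = (\<Sum>k<n. \<kappa> (n - k) * (\<Sum>\<pi>\<in>interval_partitions k. ?w \<pi>))"
    by (subst sum.Sigma[symmetric]) (auto simp: finite_interval_partitions sum_distrib_left)
  finally show ?thesis .
qed

text \<open>Both sides are the last-block decomposition of the moment-cumulant formula: in a word with
  equal letters the cumulant of a block depends on its size only.\<close>

lemma moment_recursion:
  assumes "\<psi> 1 = 1" "n > 0"
  shows "\<psi> (x ^ n) = (\<Sum>k<n. boolean_cumulant_var \<psi> (n - k) x * \<psi> (x ^ k))"
proof -
  let ?K = "\<lambda>r. boolean_cumulant_var \<psi> r x"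
  have moment: "\<psi> (x ^ m) = (\<Sum>\<pi>\<in>interval_partitions m. \<Prod>B\<in>\<pi>. ?K (card B))" for m
  proof (cases "m = 0")
    case True
    then show ?thesis using assms(1) by (simp add: interval_partitions_0)
  next
    case False
    have "nths (replicate m x) B = replicate (card B) x"
      if "\<pi> \<in> interval_partitions m" "B \<in> \<pi>" for \<pi> B
    proof -
      have "B \<subseteq> {..<m}" using that by (auto simp: interval_partitions_def partition_on_def)
      then have "{i. i < m \<and> i \<in> B} = B" by auto
      then have "length (nths (replicate m x) B) = card B" by (simp add: length_nths)
      then show ?thesis
        using set_nths_subset[of "replicate m x" B] by (intro replicate_eqI) auto
    qed
    moreover have "prod_list (replicate m x) = x ^ m" by simp
    ultimately show ?thesis
      using moment_boolean_cumulant[of "replicate m x" \<psi>] False by simp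
  qed
  show ?thesis
    using sum_interval_partitions_last_block[OF assms(2), of ?K] by (simp only: moment)
qed

text \<open>The recursion in \<open>moment_recursion\<close> is triangular, because the term for \<open>k = 0\<close> is the cumulant
  of order \<open>n\<close> itself. Cumulants can thus be read off from a relation between generating functions.\<close>

lemma boolean_cumulant_var_eqI:
  assumes "\<psi> 1 = 1"
    and "\<And>n. n > 0 \<Longrightarrow> \<psi> (x ^ n) = (\<Sum>k<n. \<kappa> (n - k) * \<psi> (x ^ k))"
    and "n > 0"
  shows "boolean_cumulant_var \<psi> n x = \<kappa> n"
  using assms(3)
proof (induction n rule: less_induct)
  case (less n)
  have split: "(\<Sum>k<n. f k) = f 0 + (\<Sum>k\<in>{0<..<n}. f k)" for f :: "nat \<Rightarrow> complex"
  proof -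
    have "{..<n} = insert 0 {0<..<n}" using less.prems by auto
    then show ?thesis by simp
  qed
  have "(\<Sum>k<n. boolean_cumulant_var \<psi> (n - k) x * \<psi> (x ^ k)) = (\<Sum>k<n. \<kappa> (n - k) * \<psi> (x ^ k))"
    using moment_recursion[of \<psi> n x, OF assms(1) less.prems] assms(2)[OF less.prems] by simp
  moreover have "(\<Sum>k\<in>{0<..<n}. boolean_cumulant_var \<psi> (n - k) x * \<psi> (x ^ k)) =
      (\<Sum>k\<in>{0<..<n}. \<kappa> (n - k) * \<psi> (x ^ k))"
    using less.IH by (intro sum.cong) auto
  ultimately show ?case using assms(1) by (simp add: split)
qed

section \<open>Words in Boolean independent subalgebras\<close>

context nc_prob_space
begin

lemma state_module_hom: "module_hom cscale (*) \<phi>"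
  using state_linear by (simp add: linear_iff_module_hom)

lemmas state_add = module_hom.add[OF state_module_hom]
  and state_zero = module_hom.zero[OF state_module_hom]
  and state_scale = module_hom.scale[OF state_module_hom]
  and state_sum = module_hom.sum[OF state_module_hom]

lemma star_zero: "star 0 = 0"
  using star_add[of 0 0] by simp

lemma star_sum: "star (sum f A) = (\<Sum>x\<in>A. star (f x))"
  by (induction A rule: infinite_finite_induct) (simp_all add: star_zero star_add)

lemma star_one: "star 1 = 1"
  using star_mult[of "star 1" 1] by (simp add: star_star)

lemma star_power: "star x = x \<Longrightarrow> star (x ^ m) = x ^ m"
  by (induction m) (simp_all add: star_one star_mult power_commutes)

text \<open>The spans of the alternating words whose first letter has index \<open>i\<close>. On them \<open>\<phi>\<close> splits off any
  factor from another subalgebra that is put in front. Multiplying by a letter from the left maps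
  these spans into each other, so the argument can proceed letter by letter and never needs
  to enumerate the words that occur in \<open>Q\<^sub>n\<^sup>m\<close>.\<close>

definition words_from :: "'i set \<Rightarrow> ('i \<Rightarrow> 'a set) \<Rightarrow> 'i \<Rightarrow> 'a set" where
  "words_from I A i = span {prod_list (map snd w) | w. w \<noteq> [] \<and>
     (\<forall>(j, x)\<in>set w. j \<in> I \<and> x \<in> A j) \<and> distinct_adj (map fst w) \<and> fst (hd w) = i}"

text \<open>A property that is linear in \<open>T\<close> may be checked on the generating words, split into their
  first letter and the rest.\<close>

lemma words_from_induct [consumes 1, case_names subspace letter word]:
  assumes T: "T \<in> words_from I A k" and S: "subspace {T. P T}"
    and letter: "\<And>y. k \<in> I \<Longrightarrow> y \<in> A k \<Longrightarrow> P y"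
    and word: "\<And>y w. k \<in> I \<Longrightarrow> y \<in> A k \<Longrightarrow> w \<noteq> [] \<Longrightarrow> \<forall>(j, x)\<in>set w. j \<in> I \<and> x \<in> A j \<Longrightarrow>
      distinct_adj (map fst w) \<Longrightarrow> fst (hd w) \<noteq> k \<Longrightarrow> P (y * prod_list (map snd w))"
  shows "P T"
proof -
  have "words_from I A k \<subseteq> {T. P T}"
    unfolding words_from_def
  proof (rule span_minimal[OF _ S], clarsimp)
    fix w assume "w \<noteq> []" and w: "\<forall>x\<in>set w. case x of (j, x) \<Rightarrow> j \<in> I \<and> x \<in> A j"
      "distinct_adj (map fst w)" and k: "k = fst (hd w)"
    then obtain y v where v: "w = (k, y) # v" by (cases w) auto
    have y: "k \<in> I" "y \<in> A k" using w(1) by (auto simp: v)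
    show "P (prod_list (map snd w))"
    proof (cases "v = []")
      case True
      then show ?thesis using letter[OF y] by (simp add: v)
    next
      case False
      moreover have "distinct_adj (map fst v)" "fst (hd v) \<noteq> k"
        using w(2) False by (auto simp: v distinct_adj_Cons hd_map)
      ultimately show ?thesis using word[OF y, of v] w(1) by (auto simp: v)
    qed
  qed
  then show ?thesis using T by auto
qed

lemma letter_in_words_from: "k \<in> I \<Longrightarrow> y \<in> A k \<Longrightarrow> y \<in> words_from I A k"
  unfolding words_from_def by (rule span_base) (auto intro!: exI[of _ "[(k, y)]"])

lemma word_in_words_from:
  assumes "k \<in> I" "y \<in> A k" "w \<noteq> []" "\<forall>(j, x)\<in>set w. j \<in> I \<and> x \<in> A j"
    "distinct_adj (map fst w)" "fst (hd w) \<noteq> k"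
  shows "y * prod_list (map snd w) \<in> words_from I A k"
  unfolding words_from_def
  by (rule span_base) (use assms in \<open>auto intro!: exI[of _ "(k, y) # w"] simp: distinct_adj_Cons hd_map\<close>)

lemma subspace_mult_vimage: "subspace V \<Longrightarrow> subspace {T. x * T \<in> V}"
  by (auto simp: subspace_def distrib_left cscale_mult_right)

lemma subspace_words_from: "subspace (words_from I A k)"
  unfolding words_from_def by (rule subspace_span)

text \<open>A letter of the same index is absorbed by the first letter of each word, and so the word stays
  alternating.\<close>

lemma mult_words_from_same:
  assumes "T \<in> words_from I A k" "x \<in> A k" "\<And>y. y \<in> A k \<Longrightarrow> x * y \<in> A k"
  shows "x * T \<in> words_from I A k"
  using assms(1)
proof (induction rule: words_from_induct)
  case subspace
  show ?case
    by (intro subspace_mult_vimage subspace_words_from)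
next
  case (letter y)
  then show ?case using assms by (intro letter_in_words_from) auto
next
  case (word y w)
  then have "(x * y) * prod_list (map snd w) \<in> words_from I A k"
    using assms by (intro word_in_words_from) auto
  then show ?case by (simp add: mult.assoc)
qed

lemma mult_words_from_other:
  assumes "T \<in> words_from I A k" "x \<in> A i" "i \<in> I" "k \<noteq> i"
  shows "x * T \<in> words_from I A i"
  using assms(1)
proof (induction rule: words_from_induct)
  case subspace
  show ?case
    by (intro subspace_mult_vimage subspace_words_from)
next
  case (letter y)
  then show ?case using word_in_words_from[of i I x A "[(k, y)]"] assms by auto
next
  case (word y w)
  then show ?case using word_in_words_from[of i I x A "(k, y) # w"] assms
    by (auto simp: distinct_adj_Cons hd_map)
qed

lemma state_mult_words_from:
  assumes ind: "boolean_independent_subalgebras \<phi> I A"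
    and "T \<in> words_from I A k" "x \<in> A i" "i \<in> I" "k \<noteq> i"
  shows "\<phi> (x * T) = \<phi> x * \<phi> T"
  using assms(2)
proof (induction rule: words_from_induct)
  case subspace
  show ?case
    by (auto simp: subspace_def cscale_mult_right state_scale state_add state_zero algebra_simps)
next
  case (letter y)
  then show ?case
    using ind[unfolded boolean_independent_subalgebras_def, rule_format, of "[(i, x), (k, y)]"] assms
    by auto
next
  case (word y w)
  have "\<phi> (y * prod_list (map snd w)) = \<phi> y * prod_list (map (\<lambda>(i, x). \<phi> x) w)"
    using ind[unfolded boolean_independent_subalgebras_def, rule_format, of "(k, y) # w"] word
    by (auto simp: distinct_adj_Cons hd_map)
  moreover have "\<phi> (x * (y * prod_list (map snd w))) =
      \<phi> x * (\<phi> y * prod_list (map (\<lambda>(i, x). \<phi> x) w))"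
    using ind[unfolded boolean_independent_subalgebras_def, rule_format, of "(i, x) # (k, y) # w"]
      word assms by (auto simp: distinct_adj_Cons hd_map)
  ultimately show ?case by simp
qed

end

section \<open>Moments of quadratic forms with zero diagonal\<close>

lemma generator_in_generated_subalgebra: "x \<in> generated_subalgebra cscale {x}"
  by (auto simp: generated_subalgebra_def intro: hull_inc)

lemma generator_mult_generated_subalgebra:
  "y \<in> generated_subalgebra cscale {x} \<Longrightarrow> x * y \<in> generated_subalgebra cscale {x}"
  by (auto simp: generated_subalgebra_def hull_def is_subalgebra_def)

context nc_prob_space
begin

context
  fixes I :: "'i set" and X :: "'i \<Rightarrow> 'a" and c :: "'i \<Rightarrow> 'i \<Rightarrow> complex" and Q
  assumes finite_I: "finite I"
    and independent: "boolean_independent cscale \<phi> I X"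
    and diag: "\<And>k. c k k = 0"
  defines "Q \<equiv> \<Sum>k\<in>I. \<Sum>l\<in>I. cscale (c k l) (X k * X l)"
begin

abbreviation (input) "words_at i \<equiv> words_from I (\<lambda>i. generated_subalgebra cscale {X i}) i"

lemma letter_mult_words_from:
  assumes "i \<in> I" "k \<in> I" "T \<in> words_at k"
  shows "X i * T \<in> words_at i"
proof (cases "i = k")
  case True
  then show ?thesis
    using assms by (intro mult_words_from_same)
      (auto intro: generator_in_generated_subalgebra generator_mult_generated_subalgebra)
next
  case False
  then show ?thesis
    using assms by (intro mult_words_from_other[of T I _ k])
      (auto intro: generator_in_generated_subalgebra)
qed

lemma state_letter_mult:
  assumes "i \<in> I" "k \<noteq> i" "T \<in> words_at k"
  shows "\<phi> (X i * T) = \<phi> (X i) * \<phi> T"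
  using state_mult_words_from[OF independent[unfolded boolean_independent_def] assms(3), of "X i" i]
    assms generator_in_generated_subalgebra by blast

lemma mult_power_Suc:
  "y * Q ^ Suc m = (\<Sum>k\<in>I. \<Sum>l\<in>I. cscale (c k l) (y * (X k * (X l * Q ^ m))))"
  by (simp add: Q_def sum_distrib_left sum_distrib_right cscale_mult_left cscale_mult_right mult.assoc)

lemma letter_power_in_words_from: "i \<in> I \<Longrightarrow> X i * Q ^ m \<in> words_at i"
proof (induction m arbitrary: i)
  case 0
  then show ?case
    by (auto intro: letter_in_words_from generator_in_generated_subalgebra)
next
  case (Suc m)
  have "X i * (X k * (X l * Q ^ m)) \<in> words_at i" if "k \<in> I" "l \<in> I" for k l
    using that Suc by (blast intro: letter_mult_words_from)
  then show ?case unfolding mult_power_Suc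
    by (intro subspace_sum subspace_scale subspace_words_from)
qed

text \<open>Here and in \<open>moment_letter_power_Suc\<close> the zero diagonal is essential: it keeps \<open>k \<noteq> l\<close>, so that
  \<open>X\<^sub>k\<close> meets a word that begins with another letter and can be split off.\<close>

lemma moment_power_Suc:
  "\<phi> (Q ^ Suc m) = (\<Sum>k\<in>I. \<Sum>l\<in>I. c k l * (\<phi> (X k) * \<phi> (X l * Q ^ m)))"
proof -
  have "\<phi> (Q ^ Suc m) = (\<Sum>k\<in>I. \<Sum>l\<in>I. c k l * \<phi> (X k * (X l * Q ^ m)))"
    using mult_power_Suc[of 1 m] by (simp add: state_sum state_scale)
  also have "\<dots> = (\<Sum>k\<in>I. \<Sum>l\<in>I. c k l * (\<phi> (X k) * \<phi> (X l * Q ^ m)))"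
  proof (intro sum.cong refl)
    fix k l assume "k \<in> I" "l \<in> I"
    then show "c k l * \<phi> (X k * (X l * Q ^ m)) = c k l * (\<phi> (X k) * \<phi> (X l * Q ^ m))"
      using state_letter_mult[of k l, OF _ _ letter_power_in_words_from] by (cases "k = l") (auto simp: diag)
  qed
  finally show ?thesis .
qed

lemma moment_letter_power_Suc:
  assumes "i \<in> I"
  shows "\<phi> (X i * Q ^ Suc m) = (\<Sum>k\<in>I. \<Sum>l\<in>I. c k l *
    ((if k = i then \<phi> (X i * X i) else \<phi> (X i) * \<phi> (X k)) * \<phi> (X l * Q ^ m)))"
proof -
  have "\<phi> (X i * Q ^ Suc m) = (\<Sum>k\<in>I. \<Sum>l\<in>I. c k l * \<phi> (X i * (X k * (X l * Q ^ m))))"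
    unfolding mult_power_Suc by (simp add: state_sum state_scale)
  also have "\<dots> = (\<Sum>k\<in>I. \<Sum>l\<in>I. c k l *
    ((if k = i then \<phi> (X i * X i) else \<phi> (X i) * \<phi> (X k)) * \<phi> (X l * Q ^ m)))"
  proof (intro sum.cong refl)
    fix k l assume kl: "k \<in> I" "l \<in> I"
    have T: "X l * Q ^ m \<in> words_at l" by (rule letter_power_in_words_from[OF kl(2)])
    show "c k l * \<phi> (X i * (X k * (X l * Q ^ m))) = c k l *
      ((if k = i then \<phi> (X i * X i) else \<phi> (X i) * \<phi> (X k)) * \<phi> (X l * Q ^ m))"
    proof (cases "k = l")
      case True
      then show ?thesis by (simp add: diag)
    next
      case kl': False
      show ?thesis
      proof (cases "k = i")
        case True
        have "X i * X i \<in> generated_subalgebra cscale {X i}"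
          by (intro generator_mult_generated_subalgebra generator_in_generated_subalgebra)
        then have "\<phi> ((X i * X i) * (X l * Q ^ m)) = \<phi> (X i * X i) * \<phi> (X l * Q ^ m)"
          using state_mult_words_from[OF independent[unfolded boolean_independent_def] T, of "X i * X i" i]
            kl' True assms by blast
        then show ?thesis using True by (simp add: mult.assoc)
      next
        case False
        then have "\<phi> (X i * (X k * (X l * Q ^ m))) = \<phi> (X i) * \<phi> (X k * (X l * Q ^ m))"
          using state_letter_mult[of i k] letter_mult_words_from[OF kl T] assms by blast
        also have "\<phi> (X k * (X l * Q ^ m)) = \<phi> (X k) * \<phi> (X l * Q ^ m)"
          using state_letter_mult[of k l] T kl kl' by blast
        finally show ?thesis using False by (simp add: mult.assoc)
      qed
    qed
  qed
  finally show ?thesis .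
qed

text \<open>The generating-function form of the two recursions. A summand \<open>k = i\<close> of
  \<open>moment_letter_power_Suc\<close> carries the factor \<open>1 + s\<^sup>2\<close> and any other one \<open>s\<^sup>2\<close>; the common part \<open>s\<^sup>2\<close>
  adds up to the moment itself, by \<open>moment_power_Suc\<close>. This is why \<open>M\<close> appears on the right of the
  first equation. Dividing by \<open>s\<close> in \<open>h\<close> removes the remaining powers of the mean.\<close>

lemma moment_fps_system:
  fixes s :: complex
  assumes s: "s \<noteq> 0" "s\<^sup>2 = 1 / of_nat (card I)"
    and mean: "\<And>i. i \<in> I \<Longrightarrow> \<phi> (X i) = s"
    and second: "\<And>i. i \<in> I \<Longrightarrow> \<phi> (X i * X i) = 1 + s\<^sup>2"
  defines "M \<equiv> Abs_fps (\<lambda>m. \<phi> (Q ^ m))"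
    and "h \<equiv> \<lambda>i. Abs_fps (\<lambda>m. \<phi> (X i * Q ^ m) / s)"
  shows "\<And>i. i \<in> I \<Longrightarrow> h i = M + fps_X * (\<Sum>l\<in>I. fps_const (c i l) * h l)"
    and "2 * M = 1 + fps_const (1 / of_nat (card I)) * (\<Sum>i\<in>I. h i)"
proof -
  define e where "e m l = \<phi> (X l * Q ^ m) / s" for m l
  have e: "\<phi> (X l * Q ^ m) = s * e m l" for m l using s by (simp add: e_def)
  have mu: "\<phi> (Q ^ Suc m) = s\<^sup>2 * (\<Sum>k\<in>I. \<Sum>l\<in>I. c k l * e m l)" for m
    unfolding moment_power_Suc unfolding e sum_distrib_left
    by (intro sum.cong refl) (simp add: mean power2_eq_square)
  have step: "e (Suc m) i = (\<Sum>l\<in>I. c i l * e m l) + \<phi> (Q ^ Suc m)" if i: "i \<in> I" for m i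
  proof -
    have "\<phi> (X i * Q ^ Suc m) = (\<Sum>k\<in>I. \<Sum>l\<in>I. c k l *
      (((if k = i then 1 else 0) + s\<^sup>2) * (s * e m l)))"
      unfolding moment_letter_power_Suc[OF i] unfolding e
      by (intro sum.cong refl) (simp add: i mean second power2_eq_square)
    also have "\<dots> = s * (\<Sum>k\<in>I. (if k = i then (\<Sum>l\<in>I. c k l * e m l) else 0) +
        s\<^sup>2 * (\<Sum>l\<in>I. c k l * e m l))"
      unfolding sum_distrib_left[of s]
    proof (rule sum.cong[OF refl])
      fix k
      have "(\<Sum>l\<in>I. c k l * (((if k = i then 1 else 0) + s\<^sup>2) * (s * e m l))) =
          s * (((if k = i then 1 else 0) + s\<^sup>2) * (\<Sum>l\<in>I. c k l * e m l))"
        by (simp add: sum_distrib_left mult_ac)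
      then show "(\<Sum>l\<in>I. c k l * (((if k = i then 1 else 0) + s\<^sup>2) * (s * e m l))) =
          s * ((if k = i then (\<Sum>l\<in>I. c k l * e m l) else 0) + s\<^sup>2 * (\<Sum>l\<in>I. c k l * e m l))"
        by (simp add: distrib_right)
    qed
    also have "\<dots> = s * ((\<Sum>l\<in>I. c i l * e m l) + \<phi> (Q ^ Suc m))"
      using i finite_I unfolding mu by (simp add: sum.distrib sum_distrib_left)
    finally show ?thesis using s by (simp add: e_def)
  qed
  have h0: "fps_nth (h i) 0 = 1" if "i \<in> I" for i
    using that s by (simp add: h_def mean)
  have M0: "fps_nth M 0 = 1" by (simp add: M_def state_one)
  show "h i = M + fps_X * (\<Sum>l\<in>I. fps_const (c i l) * h l)" if i: "i \<in> I" for i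
  proof (rule fps_ext)
    fix m show "fps_nth (h i) m = fps_nth (M + fps_X * (\<Sum>l\<in>I. fps_const (c i l) * h l)) m"
      using h0[OF i] M0 step[OF i]
      by (cases m) (simp_all add: h_def M_def e_def[symmetric] fps_sum_nth del: power_Suc)
  qed
  show "2 * M = 1 + fps_const (1 / of_nat (card I)) * (\<Sum>i\<in>I. h i)"
  proof (rule fps_ext)
    fix m
    have "s\<^sup>2 \<noteq> 0" using s(1) by simp
    then have card: "of_nat (card I) \<noteq> (0::complex)" unfolding s(2) by (metis div_by_0)
    show "fps_nth (2 * M) m = fps_nth (1 + fps_const (1 / of_nat (card I)) * (\<Sum>i\<in>I. h i)) m"
    proof (cases m)
      case 0
      then show ?thesis using h0 M0 card by (simp add: fps_sum_nth)
    next
      case (Suc m)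
      have "(\<Sum>i\<in>I. e (Suc m) i) = of_nat (card I) * (2 * \<phi> (Q ^ Suc m))"
        using mu[of m] card by (simp add: step sum.distrib s(2) del: power_Suc)
      then show ?thesis using Suc card
        by (simp add: h_def M_def e_def[symmetric] fps_sum_nth del: power_Suc)
    qed
  qed
qed

end
end

section \<open>Solving the triangular system\<close>

text \<open>Let \<open>P k\<close> be the right-hand side for an index placed between \<open>k\<close> and \<open>k + 1\<close>: every \<open>l \<le> k\<close> is below it
  and every \<open>l > k\<close> above. Then \<open>P (i - 1)\<close> and \<open>P i\<close> differ from the equation for \<open>h i\<close> only in where
  they put \<open>h i\<close> itself, so both are multiples of \<open>h i\<close>. Eliminating \<open>h i\<close> gives a two-term relation
  that telescopes from \<open>P 0\<close> to \<open>P n\<close>. For \<open>\<alpha> = \<beta>\<close> it degenerates to \<open>P 0 = P n\<close>, which carries no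
  information; but then all \<open>P k\<close> coincide, and averaging \<open>(1 + \<alpha> z / n) h i = P 0\<close> over \<open>i\<close> takes its
  place.\<close>

lemma triangular_system:
  fixes h :: "nat \<Rightarrow> complex fps" and \<alpha> \<beta> :: complex
  assumes "n > 0"
    and h: "\<And>i. i \<in> {1..n} \<Longrightarrow> h i = M + fps_X * (\<Sum>l=1..n.
      fps_const (if i < l then \<alpha> / of_nat n else if l < i then \<beta> / of_nat n else 0) * h l)"
  defines "R \<equiv> fps_const (1 / of_nat n) * (\<Sum>i=1..n. h i)"
  shows "(M + fps_const \<alpha> * fps_X * R) * (1 + fps_const (\<beta> / of_nat n) * fps_X) ^ n =
         (M + fps_const \<beta> * fps_X * R) * (1 + fps_const (\<alpha> / of_nat n) * fps_X) ^ n"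
    and "\<alpha> = \<beta> \<Longrightarrow> (1 + fps_const (\<alpha> / of_nat n) * fps_X) * R = M + fps_const \<alpha> * fps_X * R"
proof -
  define p where "p = fps_const (\<alpha> / of_nat n) * fps_X"
  define q where "q = fps_const (\<beta> / of_nat n) * fps_X"
  define P where "P k = M + p * (\<Sum>l\<in>{k<..n}. h l) + q * (\<Sum>l=1..k. h l)" for k
  have hi: "h i = M + p * (\<Sum>l\<in>{i<..n}. h l) + q * (\<Sum>l\<in>{1..<i}. h l)" if i: "i \<in> {1..n}" for i
  proof -
    have "(\<Sum>l=1..n. fps_const (if i < l then \<alpha> / of_nat n else if l < i then \<beta> / of_nat n else 0) * h l)
      = (\<Sum>l\<in>{i<..n}. fps_const (\<alpha> / of_nat n) * h l) + (\<Sum>l\<in>{1..<i}. fps_const (\<beta> / of_nat n) * h l)"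
      (is "sum ?f _ = _")
    proof -
      have "{1..n} = insert i ({i<..n} \<union> {1..<i})" using i by auto
      then have "sum ?f {1..n} = ?f i + (sum ?f {i<..n} + sum ?f {1..<i})"
        by (simp only: finite_Un finite_greaterThanAtMost finite_atLeastLessThan conj_absorb,
            subst sum.insert, simp_all, subst sum.union_disjoint) auto
      moreover have "sum ?f {i<..n} = (\<Sum>l\<in>{i<..n}. fps_const (\<alpha> / of_nat n) * h l)"
        "sum ?f {1..<i} = (\<Sum>l\<in>{1..<i}. fps_const (\<beta> / of_nat n) * h l)"
        by (auto intro!: sum.cong)
      ultimately show ?thesis by simp
    qed
    then show ?thesis
      unfolding h[OF i] by (simp add: p_def q_def sum_distrib_left algebra_simps)
  qed
  have left: "P (i - 1) = (1 + p) * h i" and right: "P i = (1 + q) * h i" if i: "i \<in> {1..n}" for i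
  proof -
    have "{i - 1<..n} = insert i {i<..n}" "{1..i - 1} = {1..<i}" "{1..i} = insert i {1..<i}"
      using i by auto
    then show "P (i - 1) = (1 + p) * h i" "P i = (1 + q) * h i"
      using hi[OF i] by (simp_all add: P_def algebra_simps)
  qed
  have tele: "k \<le> n \<Longrightarrow> P 0 * (1 + q) ^ k = P k * (1 + p) ^ k" for k
  proof (induction k)
    case (Suc k)
    have "P 0 * (1 + q) ^ Suc k = P k * (1 + p) ^ k * (1 + q)"
      using Suc by (simp add: mult.assoc mult.left_commute)
    also have "P k = (1 + p) * h (Suc k)" using left[of "Suc k"] Suc by simp
    also have "(1 + p) * h (Suc k) * (1 + p) ^ k * (1 + q) = P (Suc k) * (1 + p) ^ Suc k"
      using right[of "Suc k"] Suc by (simp add: mult_ac)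
    finally show ?case .
  qed simp
  have const: "fps_const (c / of_nat n) = fps_const c * fps_const (1 / of_nat n)" for c :: complex
    by simp
  have p_mult: "p * H = fps_const \<alpha> * fps_X * (fps_const (1 / of_nat n) * H)"
    and q_mult: "q * H = fps_const \<beta> * fps_X * (fps_const (1 / of_nat n) * H)" for H
    unfolding p_def q_def const[of \<alpha>] const[of \<beta>] by (simp_all only: mult_ac)
  have "{0<..n} = {1..n}" by auto
  then have P0: "P 0 = M + fps_const \<alpha> * fps_X * R"
    by (simp add: P_def R_def p_mult)
  have Pn: "P n = M + fps_const \<beta> * fps_X * R"
    by (simp add: P_def R_def q_mult)
  show "(M + fps_const \<alpha> * fps_X * R) * (1 + fps_const (\<beta> / of_nat n) * fps_X) ^ n =
         (M + fps_const \<beta> * fps_X * R) * (1 + fps_const (\<alpha> / of_nat n) * fps_X) ^ n"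
    using tele[of n] unfolding P0 Pn by (simp only: p_def q_def le_refl)
  show "(1 + fps_const (\<alpha> / of_nat n) * fps_X) * R = M + fps_const \<alpha> * fps_X * R" if "\<alpha> = \<beta>"
  proof -
    have P_const: "P k = P 0" if "k \<le> n" for k
      using that
    proof (induction k)
      case (Suc k)
      then show ?case using left[of "Suc k"] right[of "Suc k"] \<open>\<alpha> = \<beta>\<close> by (simp add: p_def q_def)
    qed simp
    have "(1 + p) * (\<Sum>i=1..n. h i) = (\<Sum>i=1..n. P 0)"
      unfolding sum_distrib_left
    proof (rule sum.cong[OF refl])
      fix i assume i: "i \<in> {1..n}"
      then have "i - 1 \<le> n" by auto
      from P_const[OF this] left[OF i] show "(1 + p) * h i = P 0" by (simp only:)
    qed
    then have "(1 + p) * R = fps_const (1 / of_nat n) * (of_nat n * P 0)"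
      by (simp add: R_def mult.left_commute)
    also have "\<dots> = P 0"
      using \<open>n > 0\<close> by (simp add: mult.assoc[symmetric] fps_of_nat[symmetric])
    finally show ?thesis by (simp add: p_def P0)
  qed
qed

section \<open>The limit of the moment series\<close>

text \<open>Division of power series is continuous for coefficientwise convergence: the coefficient of
  order \<open>m\<close> of a quotient is a rational function of finitely many coefficients of numerator and
  denominator.\<close>

lemma fps_quotient_tendsto:
  fixes S A D :: "nat \<Rightarrow> complex fps"
  assumes eq: "\<forall>\<^sub>F n in sequentially. S n * D n = A n" and lim: "S' * D' = A'"
    and A: "\<And>m. (\<lambda>n. fps_nth (A n) m) \<longlonglongrightarrow> fps_nth A' m"
    and D: "\<And>m. (\<lambda>n. fps_nth (D n) m) \<longlonglongrightarrow> fps_nth D' m"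
    and "fps_nth D' 0 \<noteq> 0"
  shows "(\<lambda>n. fps_nth (S n) m) \<longlonglongrightarrow> fps_nth S' m"
proof (induction m rule: less_induct)
  case (less m)
  \<comment> \<open>The coefficient of order \<open>m\<close> of a quotient, solved from the Cauchy product.\<close>
  have solve: "fps_nth f m = (fps_nth (f * g) m - (\<Sum>i<m. fps_nth f i * fps_nth g (m - i))) / fps_nth g 0"
    if "fps_nth g 0 \<noteq> 0" for f g :: "complex fps"
  proof -
    have "fps_nth (f * g) m = (\<Sum>i<Suc m. fps_nth f i * fps_nth g (m - i))"
      by (simp add: fps_mult_nth atLeast0AtMost lessThan_Suc_atMost)
    then show ?thesis using that by simp
  qed
  have "\<forall>\<^sub>F n in sequentially. fps_nth (D n) 0 \<noteq> 0"
    using tendsto_imp_eventually_ne[OF D[of 0] assms(5)] .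
  with eq have "\<forall>\<^sub>F n in sequentially.
      (fps_nth (A n) m - (\<Sum>i<m. fps_nth (S n) i * fps_nth (D n) (m - i))) / fps_nth (D n) 0 = fps_nth (S n) m"
  proof eventually_elim
    case (elim n)
    then show ?case by (simp only: solve[OF elim(2), of "S n"])
  qed
  moreover have "(\<lambda>n. (fps_nth (A n) m - (\<Sum>i<m. fps_nth (S n) i * fps_nth (D n) (m - i))) / fps_nth (D n) 0)
    \<longlonglongrightarrow> (fps_nth A' m - (\<Sum>i<m. fps_nth S' i * fps_nth D' (m - i))) / fps_nth D' 0"
    using less assms(5) by (intro tendsto_intros A D) auto
  ultimately show ?case
    unfolding solve[OF assms(5), of S'] lim by (rule Lim_transform_eventually[rotated])
qed

text \<open>By the binomial theorem, this amounts to \<open>(n choose m) / n\<^sup>m \<longlonglongrightarrow> 1 / m!\<close>.\<close>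

lemma fps_power_tendsto_exp:
  fixes c :: complex
  shows "(\<lambda>n. fps_nth ((1 + fps_const (c / of_nat n) * fps_X) ^ n) m) \<longlonglongrightarrow> fps_nth (fps_exp c) m"
proof -
  have nth: "fps_nth ((1 + fps_const (c / of_nat n) * fps_X) ^ n) m = of_nat (n choose m) * (c / of_nat n) ^ m" for n
  proof -
    have "(1 + fps_const (c / of_nat n) * fps_X) ^ n =
        (\<Sum>k\<le>n. of_nat (n choose k) * (fps_const (c / of_nat n) * fps_X) ^ k)"
      by (subst add.commute, subst binomial_ring) simp
    also have "fps_nth \<dots> m = (\<Sum>k\<le>n. if k = m then of_nat (n choose m) * (c / of_nat n) ^ m else 0)"
      unfolding fps_sum_nth
    proof (intro sum.cong refl)
      fix k
      have "of_nat (n choose k) * (fps_const (c / of_nat n) * fps_X) ^ k =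
          fps_const (of_nat (n choose k) * (c / of_nat n) ^ k) * fps_X ^ k"
        by (simp add: power_mult_distrib fps_of_nat[symmetric] mult.assoc[symmetric])
      then show "fps_nth (of_nat (n choose k) * (fps_const (c / of_nat n) * fps_X) ^ k) m =
          (if k = m then of_nat (n choose m) * (c / of_nat n) ^ m else 0)"
        by simp
    qed
    also have "\<dots> = of_nat (n choose m) * (c / of_nat n) ^ m"
      by auto
    finally show ?thesis .
  qed
  have "(\<lambda>n. of_nat (n choose m) / of_nat n ^ m) \<longlonglongrightarrow> (1 / fact m :: complex)"
  proof (induction m)
    case (Suc m)
    have "(\<lambda>n. 1 - of_nat m * (1 / of_nat n)) \<longlonglongrightarrow> (1 - of_nat m * 0 :: complex)"
      by (intro tendsto_intros lim_1_over_n)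
    then have lim: "(\<lambda>n. 1 - of_nat m * (1 / of_nat n)) \<longlonglongrightarrow> (1 :: complex)" by simp
    have "of_nat (Suc m) \<noteq> (0 :: complex)" by (rule of_nat_neq_0)
    then have "(\<lambda>n. of_nat (n choose m) / of_nat n ^ m * (1 - of_nat m * (1 / of_nat n)) / of_nat (Suc m))
        \<longlonglongrightarrow> (1 / fact m * 1 / of_nat (Suc m) :: complex)"
      by (intro tendsto_divide tendsto_mult Suc.IH lim tendsto_const)
    moreover have "\<forall>\<^sub>F n in sequentially.
        of_nat (n choose m) / of_nat n ^ m * (1 - of_nat m * (1 / of_nat n)) / of_nat (Suc m) =
        (of_nat (n choose Suc m) / of_nat n ^ Suc m :: complex)"
      using eventually_gt_at_top[of 0]
    proof eventually_elim
      case (elim n)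
      have "of_nat n * of_nat (n choose m) =
          of_nat m * of_nat (n choose m) + of_nat (Suc m) * (of_nat (n choose Suc m) :: complex)"
        using gbinomial_mult_1[of "of_nat n :: complex" m] by (simp only: binomial_gbinomial)
      then have "of_nat (n choose Suc m) = of_nat (n choose m) * (of_nat n - of_nat m) / (of_nat (Suc m) :: complex)"
        by (simp add: field_simps del: of_nat_Suc)
      moreover have "1 - of_nat m * (1 / of_nat n) = (of_nat n - of_nat m) / (of_nat n :: complex)"
        using elim by (simp add: diff_divide_distrib)
      ultimately show ?case by (simp add: mult_ac del: of_nat_Suc)
    qed
    ultimately have "(\<lambda>n. of_nat (n choose Suc m) / of_nat n ^ Suc m)
        \<longlonglongrightarrow> (1 / fact m * 1 / of_nat (Suc m) :: complex)"
      by (rule Lim_transform_eventually)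
    then show ?case by (simp add: mult.commute)
  qed simp
  then have "(\<lambda>n. of_nat (n choose m) / of_nat n ^ m * c ^ m) \<longlonglongrightarrow> 1 / fact m * c ^ m"
    by (rule tendsto_mult_right)
  then show ?thesis unfolding nth by (simp add: power_divide mult.commute)
qed

text \<open>This is \<open>1 + H\<close> for the \<open>H\<close>-transform of the limit. In terms of \<open>\<alpha> = a + ib\<close> and \<open>\<beta> = a - ib\<close> it reads
  \<open>(exp (\<alpha> z) - exp (\<beta> z)) / (z (\<alpha> exp (\<beta> z) - \<beta> exp (\<alpha> z)))\<close>; numerator and denominator both vanish
  identically at \<open>b = 0\<close>, where the limit \<open>1 / (1 - a z)\<close> takes their place. The constant coefficient
  \<open>1\<close>, which is no cumulant, is kept because it makes the quotients simpler.\<close>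

definition limit_cumulant_fps :: "real \<Rightarrow> real \<Rightarrow> complex fps" where
  "limit_cumulant_fps a b =
     (if b = 0 then inverse (1 - fps_const (of_real a) * fps_X)
      else fps_shift 1 (fps_exp (Complex a b) - fps_exp (Complex a (- b))) *
           inverse (fps_const (Complex a b) * fps_exp (Complex a (- b)) -
                    fps_const (Complex a (- b)) * fps_exp (Complex a b)))"

lemma limit_cumulant_fps_zero:
  "limit_cumulant_fps a 0 * (1 - fps_const (of_real a) * fps_X) = 1"
  unfolding limit_cumulant_fps_def by (simp add: inverse_mult_eq_1)

lemma Complex_minus_cnj: "Complex a b - Complex a (- b) = 2 * \<i> * of_real b"
  by (simp add: complex_eq_iff)

lemma limit_cumulant_fps_nonzero:
  assumes "b \<noteq> 0"
  shows "limit_cumulant_fps a b *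
      (fps_const (Complex a b) * fps_exp (Complex a (- b)) -
       fps_const (Complex a (- b)) * fps_exp (Complex a b)) =
    fps_shift 1 (fps_exp (Complex a b) - fps_exp (Complex a (- b)))"
proof -
  let ?N = "fps_const (Complex a b) * fps_exp (Complex a (- b)) -
       fps_const (Complex a (- b)) * fps_exp (Complex a b)"
  have "fps_nth ?N 0 \<noteq> 0"
    using assms by (simp add: Complex_minus_cnj)
  then have "inverse ?N * ?N = 1" by (rule inverse_mult_eq_1)
  then show ?thesis using assms by (simp add: limit_cumulant_fps_def mult.assoc)
qed

lemma limit_cumulant_fps_nth_0: "fps_nth (limit_cumulant_fps a b) 0 = 1"
proof (cases "b = 0")
  case True
  then show ?thesis by (simp add: limit_cumulant_fps_def)
next
  case False
  then have "Complex a b - Complex a (- b) \<noteq> 0" by (simp add: Complex_minus_cnj)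
  with False show ?thesis by (simp add: limit_cumulant_fps_def)
qed

text \<open>The solution \<open>M\<close> of \<open>M = 1 + H M\<close>, with \<open>1 + H\<close> from \<open>limit_cumulant_fps\<close>.\<close>

definition limit_moment_fps :: "real \<Rightarrow> real \<Rightarrow> complex fps" where
  "limit_moment_fps a b = inverse (2 - limit_cumulant_fps a b)"

lemma limit_moment_cumulant: "limit_moment_fps a b * (2 - limit_cumulant_fps a b) = 1"
  unfolding limit_moment_fps_def
  by (rule inverse_mult_eq_1) (simp add: limit_cumulant_fps_nth_0)

lemma limit_moment_fps_nth_0: "fps_nth (limit_moment_fps a b) 0 = 1"
  by (simp add: limit_moment_fps_def limit_cumulant_fps_nth_0)

lemma limit_moment_recursion:
  assumes "m > 0"
  shows "fps_nth (limit_moment_fps a b) m =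
    (\<Sum>k<m. fps_nth (limit_cumulant_fps a b) (m - k) * fps_nth (limit_moment_fps a b) k)"
proof -
  let ?M = "limit_moment_fps a b" and ?S = "limit_cumulant_fps a b"
  have "?M + ?M = 1 + ?M * ?S" using limit_moment_cumulant[of a b] by (simp add: algebra_simps)
  then have "fps_nth (?M + ?M) m = fps_nth (1 + ?M * ?S) m" by simp
  moreover have "fps_nth (?M * ?S) m = (\<Sum>k\<le>m. fps_nth ?M k * fps_nth ?S (m - k))"
    by (simp add: fps_mult_nth atLeast0AtMost)
  ultimately have "fps_nth ?M m + fps_nth ?M m = (\<Sum>k\<le>m. fps_nth ?M k * fps_nth ?S (m - k))"
    using assms by (simp only: fps_add_nth fps_one_nth) simp
  also have "\<dots> = fps_nth ?M m + (\<Sum>k<m. fps_nth ?M k * fps_nth ?S (m - k))"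
    by (simp add: lessThan_Suc_atMost[symmetric] limit_cumulant_fps_nth_0)
  finally show ?thesis by (simp add: mult.commute)
qed

text \<open>For \<open>b \<noteq> 0\<close> insert \<open>R = 2 M - 1\<close> into the telescoped identity and put \<open>N = \<alpha> v - \<beta> u\<close>, with
  \<open>u = (1 + \<alpha> z / n)\<^sup>n\<close> and \<open>v = (1 + \<beta> z / n)\<^sup>n\<close>. Then \<open>M (u - v) = z (2 M - 1) N\<close>, and since \<open>u - v\<close> has no
  constant term, a factor \<open>z\<close> cancels: \<open>M (2 N - (u - v) / z) = N\<close>. The second factor has the
  constant coefficient \<open>\<alpha> - \<beta> = 2 i b \<noteq> 0\<close>, so that \<open>fps_quotient_tendsto\<close> applies.\<close>

lemma moment_fps_tendsto:
  fixes M :: "nat \<Rightarrow> complex fps" and h :: "nat \<Rightarrow> nat \<Rightarrow> complex fps"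
  assumes system: "\<And>n i. n > 0 \<Longrightarrow> i \<in> {1..n} \<Longrightarrow> h n i = M n + fps_X * (\<Sum>l=1..n.
      fps_const (if i < l then Complex a b / of_nat n else if l < i then Complex a (- b) / of_nat n else 0) * h n l)"
    and mean: "\<And>n. n > 0 \<Longrightarrow> 2 * M n = 1 + fps_const (1 / of_nat n) * (\<Sum>i=1..n. h n i)"
  shows "(\<lambda>n. fps_nth (M n) m) \<longlonglongrightarrow> fps_nth (limit_moment_fps a b) m"
proof -
  let ?M = "limit_moment_fps a b" and ?S = "limit_cumulant_fps a b"
  define \<alpha> \<beta> where "\<alpha> = Complex a b" and "\<beta> = Complex a (- b)"
  define u v where "u n = (1 + fps_const (\<alpha> / of_nat n) * fps_X) ^ n"
    and "v n = (1 + fps_const (\<beta> / of_nat n) * fps_X) ^ n" for n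
  have R: "fps_const (1 / of_nat n) * (\<Sum>i=1..n. h n i) = 2 * M n - 1" if "n > 0" for n
    using mean[OF that] by simp
  have solved: "(M n + fps_const \<alpha> * fps_X * (2 * M n - 1)) * v n =
      (M n + fps_const \<beta> * fps_X * (2 * M n - 1)) * u n"
    "\<alpha> = \<beta> \<Longrightarrow> (1 + fps_const (\<alpha> / of_nat n) * fps_X) * (2 * M n - 1) =
      M n + fps_const \<alpha> * fps_X * (2 * M n - 1)" if "n > 0" for n
    using triangular_system[OF that system[OF that]]
    unfolding R[OF that] \<alpha>_def \<beta>_def u_def v_def by blast+
  have M: "?M * (2 - ?S) = 1" by (rule limit_moment_cumulant)
  show ?thesis
  proof (cases "b = 0")
    case True
    then have \<alpha>\<beta>: "\<alpha> = of_real a" "\<beta> = \<alpha>" by (simp_all add: \<alpha>_def \<beta>_def complex_eq_iff)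
    define A where "A n = 1 + fps_const (\<alpha> / of_nat n) * fps_X - fps_const \<alpha> * fps_X" for n
    have "M n * (2 * A n - 1) = A n" if "n > 0" for n
      using solved(2)[OF that] that \<alpha>\<beta>(2) by (simp add: A_def algebra_simps)
    then have eq: "\<forall>\<^sub>F n in sequentially. M n * (2 * A n - 1) = A n"
      by (rule eventually_mono[OF eventually_gt_at_top])
    define A' where "A' = 1 - fps_const \<alpha> * fps_X"
    have "?S * A' = 1" using limit_cumulant_fps_zero[of a] True by (simp add: A'_def \<alpha>\<beta>)
    then have "2 * A' - 1 = (2 - ?S) * A'" by (simp add: algebra_simps)
    then have lim: "?M * (2 * A' - 1) = A'" using M by (simp add: mult.assoc[symmetric])
    have "(\<lambda>n. \<alpha> * (1 / of_nat n)) \<longlonglongrightarrow> \<alpha> * 0"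
      by (intro tendsto_intros lim_1_over_n)
    then have "(\<lambda>n. \<alpha> / of_nat n) \<longlonglongrightarrow> 0" by simp
    then have "(\<lambda>n. fps_nth 1 m + \<alpha> / of_nat n * fps_nth fps_X m - \<alpha> * fps_nth fps_X m)
        \<longlonglongrightarrow> fps_nth 1 m + 0 * fps_nth fps_X m - \<alpha> * fps_nth fps_X m" for m
      by (intro tendsto_intros)
    then have A: "(\<lambda>n. fps_nth (A n) m) \<longlonglongrightarrow> fps_nth A' m" for m
      by (simp only: A_def A'_def fps_add_nth fps_sub_nth fps_mult_left_const_nth mult_zero_left add_0_right)
    then have "(\<lambda>n. 2 * fps_nth (A n) m - fps_nth 1 m) \<longlonglongrightarrow> 2 * fps_nth A' m - fps_nth 1 m" for m
      by (intro tendsto_intros)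
    then have D: "(\<lambda>n. fps_nth (2 * A n - 1) m) \<longlonglongrightarrow> fps_nth (2 * A' - 1) m" for m
      by simp
    show ?thesis
      by (rule fps_quotient_tendsto[OF eq lim A D]) (simp add: A'_def)
  next
    case False
    define N D where "N n = fps_const \<alpha> * v n - fps_const \<beta> * u n"
      and "D n = 2 * N n - fps_shift 1 (u n - v n)" for n
    define N' D' where "N' = fps_const \<alpha> * fps_exp \<beta> - fps_const \<beta> * fps_exp \<alpha>"
      and "D' = 2 * N' - fps_shift 1 (fps_exp \<alpha> - fps_exp \<beta>)"
    have "M n * D n = N n" if "n > 0" for n
    proof -
      have "fps_nth (u n - v n) 0 = 0" by (simp add: u_def v_def fps_power_zeroth)
      then have shift: "fps_X * fps_shift 1 (u n - v n) = u n - v n"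
      proof (intro fps_ext)
        fix k show "fps_nth (fps_X * fps_shift 1 (u n - v n)) k = fps_nth (u n - v n) k"
          using \<open>fps_nth (u n - v n) 0 = 0\<close> by (cases k) simp_all
      qed
      have "fps_X * (M n * D n) = 2 * fps_X * M n * N n - M n * (fps_X * fps_shift 1 (u n - v n))"
        by (simp add: D_def algebra_simps)
      also have "M n * (fps_X * fps_shift 1 (u n - v n)) = fps_X * (2 * M n - 1) * N n"
        unfolding shift using solved(1)[OF that] by (simp add: N_def algebra_simps)
      also have "2 * fps_X * M n * N n - fps_X * (2 * M n - 1) * N n = fps_X * N n"
        by (simp add: algebra_simps)
      finally have "fps_X * (M n * D n) = fps_X * N n" .
      then show ?thesis by simp
    qed
    then have eq: "\<forall>\<^sub>F n in sequentially. M n * D n = N n"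
      by (rule eventually_mono[OF eventually_gt_at_top])
    have "?S * N' = fps_shift 1 (fps_exp \<alpha> - fps_exp \<beta>)"
      unfolding N'_def \<alpha>_def \<beta>_def by (rule limit_cumulant_fps_nonzero[OF False])
    then have "D' = (2 - ?S) * N'" by (simp add: D'_def algebra_simps)
    then have lim: "?M * D' = N'" using M by (simp add: mult.assoc[symmetric])
    have u: "(\<lambda>n. fps_nth (u n) m) \<longlonglongrightarrow> fps_nth (fps_exp \<alpha>) m"
      and v: "(\<lambda>n. fps_nth (v n) m) \<longlonglongrightarrow> fps_nth (fps_exp \<beta>) m" for m
      unfolding u_def v_def by (rule fps_power_tendsto_exp)+
    have N: "(\<lambda>n. fps_nth (N n) m) \<longlonglongrightarrow> fps_nth N' m" for m
      using tendsto_diff[OF tendsto_mult[OF tendsto_const v] tendsto_mult[OF tendsto_const u]]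
      by (simp add: N_def N'_def del: fps_exp_nth)
    have D: "(\<lambda>n. fps_nth (D n) m) \<longlonglongrightarrow> fps_nth D' m" for m
      using tendsto_diff[OF tendsto_mult[OF tendsto_const N[of m], of 2] tendsto_diff[OF u[of "Suc m"] v[of "Suc m"]]]
      by (simp add: D_def D'_def del: fps_exp_nth)
    have "fps_nth D' 0 = \<alpha> - \<beta>" by (simp add: D'_def N'_def)
    also have "\<dots> \<noteq> 0" using False by (simp add: \<alpha>_def \<beta>_def Complex_minus_cnj)
    finally show ?thesis by (rule fps_quotient_tendsto[OF eq lim N D])
  qed
qed

section \<open>The H-transform of the limit\<close>

lemma has_fps_expansion_transform_eventually:
  assumes "f has_fps_expansion F" "\<forall>\<^sub>F z in nhds 0. f z = g z"
  shows "g has_fps_expansion F"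
proof -
  have "\<forall>\<^sub>F z in nhds 0. eval_fps F z = f z"
    using assms(1) by (simp add: has_fps_expansion_def)
  with assms(2) have "\<forall>\<^sub>F z in nhds 0. eval_fps F z = g z"
    by eventually_elim simp
  with assms(1) show ?thesis by (simp add: has_fps_expansion_def)
qed

text \<open>For \<open>b \<noteq> 0\<close> Euler's formula gives \<open>exp (\<alpha> z) - exp (\<beta> z) = 2 i exp (a z) sin (b z)\<close> and
  \<open>\<alpha> exp (\<beta> z) - \<beta> exp (\<alpha> z) = 2 i exp (a z) (b cos (b z) - a sin (b z))\<close>. The quotient is
  the tangent formula wherever \<open>cos (b z) \<noteq> 0\<close>, in particular near \<open>0\<close>.\<close>

lemma has_fps_expansion_limit_cumulant:
  "(\<lambda>z. 1 + limit_H a b z) has_fps_expansion limit_cumulant_fps a b"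
proof -
  have near: "\<forall>\<^sub>F z in nhds (0::complex). of_real a * z \<noteq> 1"
  proof -
    have "((\<lambda>z. of_real a * z) \<longlongrightarrow> of_real a * (0::complex)) (nhds 0)"
      by (intro tendsto_intros filterlim_ident)
    then show ?thesis by (auto elim: tendsto_imp_eventually_ne)
  qed
  show ?thesis
  proof (cases "b = 0")
    case True
    have "(\<lambda>z. inverse (1 - of_real a * z)) has_fps_expansion limit_cumulant_fps a b"
      unfolding limit_cumulant_fps_def using True
      by (auto intro!: has_fps_expansion_inverse has_fps_expansion_diff has_fps_expansion_cmult_left has_fps_expansion_fps_X)
    then show ?thesis
    proof (rule has_fps_expansion_transform_eventually)
      show "\<forall>\<^sub>F z in nhds 0. inverse (1 - of_real a * z) = 1 + limit_H a b z"
        using near by eventually_elim (simp add: limit_H_degenerate True inverse_eq_divide)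
    qed
  next
    case False
    define \<alpha> \<beta> where "\<alpha> = Complex a b" and "\<beta> = Complex a (- b)"
    have \<alpha>\<beta>: "\<alpha> = of_real a + \<i> * of_real b" "\<beta> = of_real a - \<i> * of_real b"
      by (simp_all add: \<alpha>_def \<beta>_def complex_eq_iff)
    have ne: "\<alpha> - \<beta> \<noteq> 0" using False by (simp add: \<alpha>_def \<beta>_def Complex_minus_cnj)
    let ?F = "fps_exp \<alpha> - fps_exp \<beta>"
    have "fps_nth ?F 1 = \<alpha> - \<beta>" by simp
    then have "?F \<noteq> 0" using ne by (metis fps_zero_nth)
    then have sub: "1 \<le> subdegree ?F" by (intro subdegree_geI) auto
    have "(\<lambda>z. (if z = 0 then \<alpha> - \<beta> else (exp (\<alpha> * z) - exp (\<beta> * z)) / z ^ 1) *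
        inverse (\<alpha> * exp (\<beta> * z) - \<beta> * exp (\<alpha> * z))) has_fps_expansion
        (fps_shift 1 ?F * inverse (fps_const \<alpha> * fps_exp \<beta> - fps_const \<beta> * fps_exp \<alpha>))"
      using sub ne by (intro fps_expansion_intros) auto
    also have "fps_shift 1 ?F * inverse (fps_const \<alpha> * fps_exp \<beta> - fps_const \<beta> * fps_exp \<alpha>) =
        limit_cumulant_fps a b"
      using False by (simp add: limit_cumulant_fps_def \<alpha>_def \<beta>_def)
    finally show ?thesis
    proof (rule has_fps_expansion_transform_eventually)
      have "((\<lambda>z. cos (of_real b * z)) \<longlongrightarrow> cos (of_real b * (0::complex))) (nhds 0)"
        by (intro tendsto_intros filterlim_ident)
      then have "\<forall>\<^sub>F z in nhds (0::complex). cos (of_real b * z) \<noteq> 0"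
        by (rule tendsto_imp_eventually_ne) simp
      then show "\<forall>\<^sub>F z in nhds 0. (if z = 0 then \<alpha> - \<beta> else (exp (\<alpha> * z) - exp (\<beta> * z)) / z ^ 1) *
        inverse (\<alpha> * exp (\<beta> * z) - \<beta> * exp (\<alpha> * z)) = 1 + limit_H a b z"
      proof eventually_elim
        case (elim z)
        show ?case
        proof (cases "z = 0")
          case True
          then show ?thesis using ne by (simp add: limit_H_degenerate)
        next
          case z: False
          define C S E where "C = cos (of_real b * z)" and "S = sin (of_real b * z)"
            and "E = exp (of_real a * z)"
          have euler: "C + \<i> * S = exp (\<i> * (of_real b * z))" "C - \<i> * S = exp (- (\<i> * (of_real b * z)))"
            using exp_Euler[of "of_real b * z"] exp_Euler[of "- (of_real b * z)"]
            by (simp_all add: C_def S_def)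
          have exps: "exp (\<alpha> * z) = E * (C + \<i> * S)" "exp (\<beta> * z) = E * (C - \<i> * S)"
            unfolding euler E_def exp_add[symmetric]
            by (simp_all add: \<alpha>\<beta> ring_distribs mult.assoc)
          have num: "exp (\<alpha> * z) - exp (\<beta> * z) = 2 * \<i> * E * S"
            by (simp add: exps algebra_simps)
          have den: "\<alpha> * exp (\<beta> * z) - \<beta> * exp (\<alpha> * z) = 2 * \<i> * E * (of_real b * C - of_real a * S)"
            unfolding exps unfolding \<alpha>\<beta> by (simp add: algebra_simps)
          have cancel: "K * S / z ^ 1 * inverse (K * W) = 1 / z * (S / W)" if "K \<noteq> 0" for K W :: complex
            using that z by (cases "W = 0") (simp_all add: field_simps)
          have "2 * \<i> * E \<noteq> 0" by (simp add: E_def)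
          then have "(exp (\<alpha> * z) - exp (\<beta> * z)) / z ^ 1 * inverse (\<alpha> * exp (\<beta> * z) - \<beta> * exp (\<alpha> * z)) =
              1 / z * (S / (of_real b * C - of_real a * S))"
            unfolding num den by (rule cancel)
          also have "of_real b * C - of_real a * S = C * (of_real b - of_real a * tan (of_real b * z))"
            using elim by (simp add: tan_def C_def S_def algebra_simps)
          also have "S / (C * (of_real b - of_real a * tan (of_real b * z))) =
              tan (of_real b * z) / (of_real b - of_real a * tan (of_real b * z))"
            by (simp add: tan_def C_def S_def)
          finally show ?thesis using z False by (simp add: limit_H_def tan_formula_def)
        qed
      qed
    qed
  qed
qed

lemma limit_cumulant_fps_sums_limit_H:
  "\<forall>\<^sub>F z in nhds 0. (\<lambda>m. fps_nth (limit_cumulant_fps a b) (Suc m) * z ^ Suc m) sums limit_H a b z"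
proof -
  let ?S = "limit_cumulant_fps a b"
  have eval: "\<forall>\<^sub>F z in nhds 0. eval_fps ?S z = 1 + limit_H a b z"
    and radius: "fps_conv_radius ?S > 0"
    using has_fps_expansion_limit_cumulant[of a b] by (auto simp: has_fps_expansion_def)
  have "\<forall>\<^sub>F z in nhds 0. z \<in> eball 0 (fps_conv_radius ?S)"
    using radius by (intro eventually_nhds_in_open) (auto simp: zero_ereal_def)
  with eval show ?thesis
  proof eventually_elim
    case (elim z)
    have "(\<lambda>m. fps_nth ?S m * z ^ m) sums (1 + limit_H a b z)"
      using sums_eval_fps[of z ?S] elim by simp
    from sums_split_initial_segment[OF this, of 1] show ?case
      by (simp add: limit_cumulant_fps_nth_0)
  qed
qed

section \<open>States with prescribed limit moments\<close>

definition poly_functional :: "(nat \<Rightarrow> complex) \<Rightarrow> complex poly \<Rightarrow> complex" where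
  "poly_functional \<mu> p = (\<Sum>i\<le>degree p. coeff p i * \<mu> i)"

lemma poly_functional_altdef:
  assumes "degree p \<le> n"
  shows "poly_functional \<mu> p = (\<Sum>i\<le>n. coeff p i * \<mu> i)"
  unfolding poly_functional_def
  by (rule sum.mono_neutral_left) (use assms in \<open>auto simp: coeff_eq_0\<close>)

lemma poly_functional_add: "poly_functional \<mu> (p + q) = poly_functional \<mu> p + poly_functional \<mu> q"
proof -
  let ?n = "max (degree p) (degree q)"
  have "degree (p + q) \<le> ?n" by (rule degree_add_le) auto
  then show ?thesis
    by (simp add: poly_functional_altdef[of _ ?n] sum.distrib distrib_right)
qed

lemma poly_functional_smult: "poly_functional \<mu> (smult c p) = c * poly_functional \<mu> p"
  by (simp add: poly_functional_altdef[of _ "degree p"] degree_smult_le sum_distrib_left mult.assoc)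

lemma poly_functional_linear: "Vector_Spaces.linear smult (*) (poly_functional \<mu>)"
  by unfold_locales
     (simp_all add: poly_functional_add poly_functional_smult smult_add_right smult_add_left algebra_simps)

lemma poly_functional_monom: "poly_functional \<mu> (monom c m) = c * \<mu> m"
proof -
  have "poly_functional \<mu> (monom c m) = (\<Sum>i\<le>m. if i = m then c * \<mu> i else 0)"
    unfolding poly_functional_altdef[OF degree_monom_le] by (intro sum.cong) auto
  then show ?thesis by simp
qed

lemma poly_functional_sum: "poly_functional \<mu> (sum f A) = (\<Sum>x\<in>A. poly_functional \<mu> (f x))"
  by (induction A rule: infinite_finite_induct)
     (simp_all add: poly_functional_add, simp_all add: poly_functional_def)

lemma poly_functional_X_power: "poly_functional \<mu> ([:0, 1:] ^ m) = \<mu> m"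
proof -
  have "[:0, 1:] ^ m = (monom 1 m :: complex poly)" by (simp add: monom_altdef)
  then show ?thesis
    by (simp add: poly_functional_monom)
qed

lemma star_algebra_poly: "star_algebra smult (map_poly cnj)"
proof
  show "map_poly cnj (p * q) = map_poly cnj q * map_poly cnj p" for p q :: "complex poly"
    by (subst mult.commute) (simp add: poly_eq_iff coeff_map_poly coeff_mult)
qed (auto simp: smult_add_right smult_add_left poly_eq_iff coeff_map_poly)

context nc_prob_space
begin

definition eval_poly :: "complex poly \<Rightarrow> 'a \<Rightarrow> 'a" where
  "eval_poly p x = (\<Sum>i\<le>degree p. cscale (coeff p i) (x ^ i))"

lemma state_star_eval_poly_mult:
  assumes "star x = x"
  shows "\<phi> (star (eval_poly p x) * eval_poly p x) = poly_functional (\<lambda>m. \<phi> (x ^ m)) (map_poly cnj p * p)"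
proof -
  let ?n = "degree p"
  have "\<phi> (star (eval_poly p x) * eval_poly p x) =
      (\<Sum>i\<le>?n. \<Sum>j\<le>?n. cnj (coeff p i) * coeff p j * \<phi> (x ^ (i + j)))"
    by (simp add: eval_poly_def star_sum star_cscale star_power assms sum_product cscale_mult_left
        cscale_mult_right state_sum state_scale power_add mult_ac)
  also have "\<dots> = poly_functional (\<lambda>m. \<phi> (x ^ m))
      (\<Sum>i\<le>?n. \<Sum>j\<le>?n. monom (coeff (map_poly cnj p) i) i * monom (coeff p j) j)"
    by (simp add: poly_functional_sum poly_functional_monom mult_monom coeff_map_poly)
  also have "(\<Sum>i\<le>?n. \<Sum>j\<le>?n. monom (coeff (map_poly cnj p) i) i * monom (coeff p j) j) =
      map_poly cnj p * p"
    unfolding sum_product[symmetric]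
    by (simp only: poly_as_sum_of_monoms poly_as_sum_of_monoms'[OF map_poly_degree_leq])
  finally show ?thesis .
qed

end

text \<open>At each \<open>p\<^sup>* p\<close> the functional is a limit of the nonnegative numbers \<open>\<phi>\<^sub>n(p(Q\<^sub>n)\<^sup>* p(Q\<^sub>n))\<close>, and
  the nonnegative reals are closed.\<close>

lemma state_of_limit_moments:
  fixes \<phi> :: "nat \<Rightarrow> 'a::ring_1 \<Rightarrow> complex"
  assumes space: "\<forall>\<^sub>F n in sequentially. nc_prob_space cscale star (\<phi> n) \<and> star (Q n) = Q n"
    and lim: "\<And>m. (\<lambda>n. \<phi> n (Q n ^ m)) \<longlonglongrightarrow> \<mu> m"
  shows "nc_prob_space smult (map_poly cnj) (poly_functional \<mu>)"
proof -
  show ?thesis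
  proof (intro nc_prob_space.intro nc_prob_space_axioms.intro star_algebra_poly)
    show "Vector_Spaces.linear smult (*) (poly_functional \<mu>)" by (rule poly_functional_linear)
    have "\<forall>\<^sub>F n in sequentially. \<phi> n (Q n ^ 0) = 1"
      using space by eventually_elim (auto dest: nc_prob_space.state_one)
    then have "(\<lambda>n. \<phi> n (Q n ^ 0)) \<longlonglongrightarrow> 1"
      by (rule tendsto_eventually)
    then have "\<mu> 0 = 1" using lim[of 0] LIMSEQ_unique by blast
    then show "poly_functional \<mu> 1 = 1" by (simp add: poly_functional_def)
    fix p :: "complex poly"
    let ?pp = "map_poly cnj p * p"
    have "(\<lambda>n. poly_functional (\<lambda>m. \<phi> n (Q n ^ m)) ?pp) \<longlonglongrightarrow> poly_functional \<mu> ?pp"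
      unfolding poly_functional_def by (intro tendsto_intros lim)
    moreover have "\<forall>\<^sub>F n in sequentially. poly_functional (\<lambda>m. \<phi> n (Q n ^ m)) ?pp \<in> \<real>\<^sub>\<ge>\<^sub>0"
      using space
    proof eventually_elim
      case (elim n)
      then interpret S: nc_prob_space cscale star "\<phi> n" by simp
      show ?case
        using S.state_positive S.state_star_eval_poly_mult[of "Q n" p] elim by metis
    qed
    ultimately show "poly_functional \<mu> ?pp \<in> \<real>\<^sub>\<ge>\<^sub>0"
      by (intro Lim_in_closed_set[OF closed_nonneg_Reals_complex]) auto
  qed
qed

section \<open>Convergence of the quadratic forms\<close>

lemma sum_square_eq_sum_triangle:
  fixes f :: "nat \<Rightarrow> nat \<Rightarrow> 'c::comm_monoid_add"
  assumes "\<And>k. f k k = 0"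
  shows "(\<Sum>k=1..n. \<Sum>l=1..n. f k l) =
    (\<Sum>(k, l)\<in>{(k, l). 1 \<le> k \<and> k < l \<and> l \<le> n}. f k l + f l k)"
proof -
  have tri: "(\<Sum>k=1..n. \<Sum>l=1..n. if k < l then g k l else 0) =
      (\<Sum>(k, l)\<in>{(k, l). 1 \<le> k \<and> k < l \<and> l \<le> n}. g k l)" for g :: "nat \<Rightarrow> nat \<Rightarrow> 'c"
    unfolding sum.cartesian_product
    by (rule sum.mono_neutral_cong_right) (auto split: if_splits)
  have "f k l = (if k < l then f k l else 0) + (if l < k then f k l else 0)" for k l
    using assms[of k] by (cases k l rule: linorder_cases) auto
  then have "(\<Sum>k=1..n. \<Sum>l=1..n. f k l) =
      (\<Sum>k=1..n. \<Sum>l=1..n. if k < l then f k l else 0) + (\<Sum>k=1..n. \<Sum>l=1..n. if l < k then f k l else 0)"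
    by (simp only: sum.distrib[symmetric])
  also have "(\<Sum>k=1..n. \<Sum>l=1..n. if l < k then f k l else 0) = (\<Sum>k=1..n. \<Sum>l=1..n. if k < l then f l k else 0)"
    by (rule sum.swap)
  finally show ?thesis
    unfolding tri by (simp add: sum.distrib case_prod_beta)
qed

context star_algebra
begin

lemma quadratic_form_eq_sum:
  "quadratic_form cscale a b n x = (\<Sum>k=1..n. \<Sum>l=1..n. cscale
     (if k < l then Complex a b / of_nat n else if l < k then Complex a (- b) / of_nat n else 0)
     (x k * x l))"
proof -
  have eq: "Complex a b = of_real a + \<i> * of_real b" "Complex a (- b) = of_real a - \<i> * of_real b"
    by (simp_all add: complex_eq_iff)
  show ?thesis
    unfolding quadratic_form_def scale_sum_right
    by (subst sum_square_eq_sum_triangle)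
       (auto intro!: sum.cong simp: eq scale_right_distrib scale_right_diff_distrib
         scale_left_distrib scale_left_diff_distrib add_divide_distrib diff_divide_distrib)
qed

end

text \<open>Anticommutators of self-adjoint elements are self-adjoint, and commutators are
  anti-self-adjoint, which the imaginary coefficient corrects.\<close>

lemma (in nc_prob_space) star_quadratic_form:
  assumes "\<And>i. i \<in> {1..n} \<Longrightarrow> star (x i) = x i"
  shows "star (quadratic_form cscale a b n x) = quadratic_form cscale a b n x"
proof -
  have [simp]: "star (y - z) = star y - star z" for y z
    using star_add[of "y - z" z] by (simp add: algebra_simps)
  have "cscale (- (\<i> * of_real b)) (y - z) = cscale (\<i> * of_real b) (z - y)" for y z
    by (metis minus_diff_eq scale_minus_left scale_minus_right)
  then show ?thesis
    unfolding quadratic_form_def star_cscale star_sum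
    by (auto intro!: arg_cong[where f = "cscale _"] sum.cong
      simp: star_add star_cscale star_mult assms add.commute)
qed

lemma quadratic_form_moment_tendsto:
  assumes space: "\<And>n. n \<ge> 1 \<Longrightarrow> nc_prob_space cscale star (\<phi> n)"
    and ind: "\<And>n. n \<ge> 1 \<Longrightarrow> boolean_independent cscale (\<phi> n) {1..n} (X n)"
    and mean: "\<And>n i. i \<in> {1..n} \<Longrightarrow> \<phi> n (X n i) = of_real (1 / sqrt (real n))"
    and var: "\<And>n i. i \<in> {1..n} \<Longrightarrow> variance_of (\<phi> n) (X n i) = 1"
  shows "(\<lambda>n. \<phi> n (quadratic_form cscale a b n (X n) ^ m)) \<longlonglongrightarrow> fps_nth (limit_moment_fps a b) m"
proof -
  define s where "s n = complex_of_real (1 / sqrt (real n))" for n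
  define Q where "Q n = quadratic_form cscale a b n (X n)" for n
  define c where "c n k l = (if k < l then Complex a b / of_nat n
     else if l < k then Complex a (- b) / of_nat n else 0)" for n k l :: nat
  define M where "M n = Abs_fps (\<lambda>m. \<phi> n (Q n ^ m))" for n
  define h where "h n i = Abs_fps (\<lambda>m. \<phi> n (X n i * Q n ^ m) / s n)" for n i
  have s2: "(s n)\<^sup>2 = 1 / of_nat n" for n
    by (simp add: s_def power_divide of_real_power[symmetric] del: of_real_power)
  have system: "(\<forall>i\<in>{1..n}. h n i = M n + fps_X * (\<Sum>l=1..n. fps_const (c n i l) * h n l)) \<and>
        2 * M n = 1 + fps_const (1 / of_nat n) * (\<Sum>i=1..n. h n i)" if n: "n > 0" for n
    proof -
      interpret nc_prob_space cscale star "\<phi> n" using space n by simp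
      have Q: "Q n = (\<Sum>k\<in>{1..n}. \<Sum>l\<in>{1..n}. cscale (c n k l) (X n k * X n l))"
        by (simp add: Q_def quadratic_form_eq_sum c_def)
      have second: "\<phi> n (X n i * X n i) = 1 + (s n)\<^sup>2" if "i \<in> {1..n}" for i
        using var[OF that] mean[OF that] by (simp add: variance_of_def s_def power2_eq_square algebra_simps)
      have ne: "s n \<noteq> 0" using n by (simp add: s_def)
      have sq: "(s n)\<^sup>2 = 1 / of_nat (card {1..n})" by (simp add: s2)
      have first: "\<phi> n (X n i) = s n" if "i \<in> {1..n}" for i using that by (simp add: mean s_def)
      have diag: "c n k k = 0" for k by (simp add: c_def)
      have ind_n: "boolean_independent cscale (\<phi> n) {1..n} (X n)" using ind n by simp
      note sys = moment_fps_system[where c = "c n", OF finite_atLeastAtMost ind_n diag ne sq first second]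
      have "h n i = M n + fps_X * (\<Sum>l\<in>{1..n}. fps_const (c n i l) * h n l)" if "i \<in> {1..n}" for i
        unfolding M_def h_def Q by (rule sys(1)[OF _ _ that])
      moreover have "2 * M n = 1 + fps_const (1 / of_nat (card {1..n})) * (\<Sum>i\<in>{1..n}. h n i)"
        unfolding M_def h_def Q by (rule sys(2))
      ultimately show ?thesis by simp
    qed
  have "(\<lambda>n. fps_nth (M n) m) \<longlonglongrightarrow> fps_nth (limit_moment_fps a b) m"
    using system by (intro moment_fps_tendsto[where h = h]) (auto simp: c_def)
  then show ?thesis by (simp add: M_def Q_def)
qed

theorem theorem5p4:
  fixes cscale :: "complex \<Rightarrow> 'a::ring_1 \<Rightarrow> 'a"
    and star :: "'a \<Rightarrow> 'a"
    and \<phi> :: "nat \<Rightarrow> 'a \<Rightarrow> complex"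
    and X :: "nat \<Rightarrow> nat \<Rightarrow> 'a"
    and a b :: real
  assumes "\<And>n. n \<ge> 1 \<Longrightarrow> nc_prob_space cscale star (\<phi> n)"
    and "\<And>n i. i \<in> {1..n} \<Longrightarrow> star (X n i) = X n i"
    and "\<And>n. n \<ge> 1 \<Longrightarrow> boolean_independent cscale (\<phi> n) {1..n} (X n)"
    and "identically_distributed \<phi> X"
    and "\<And>n i. i \<in> {1..n} \<Longrightarrow> \<phi> n (X n i) = of_real (1 / sqrt (real n))"
    and "\<And>n i. i \<in> {1..n} \<Longrightarrow> variance_of (\<phi> n) (X n i) = 1"
  shows "\<exists>(cscale' :: complex \<Rightarrow> complex poly \<Rightarrow> complex poly) star' \<psi> Y.
           nc_prob_space cscale' star' \<psi> \<and> star' Y = Y \<and>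
           converges_in_distribution \<phi> (\<lambda>n. quadratic_form cscale a b n (X n)) \<psi> Y \<and>
           has_H_transform \<psi> Y (limit_H a b)"
proof (intro exI conjI)
  let ?Q = "\<lambda>n. quadratic_form cscale a b n (X n)"
  let ?\<psi> = "poly_functional (fps_nth (limit_moment_fps a b))" and ?Y = "[:0, 1:] :: complex poly"
  have lim: "(\<lambda>n. \<phi> n (?Q n ^ m)) \<longlonglongrightarrow> fps_nth (limit_moment_fps a b) m" for m
    using assms by (intro quadratic_form_moment_tendsto) auto
  have "\<forall>\<^sub>F n in sequentially. nc_prob_space cscale star (\<phi> n) \<and> star (?Q n) = ?Q n"
    using eventually_ge_at_top[of 1]
    by eventually_elim (use assms(1,2) nc_prob_space.star_quadratic_form in blast)
  then show "nc_prob_space smult (map_poly cnj) ?\<psi>"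
    using lim by (rule state_of_limit_moments)
  show "map_poly cnj ?Y = ?Y" by (simp add: map_poly_pCons)
  show "converges_in_distribution \<phi> ?Q ?\<psi> ?Y"
    unfolding converges_in_distribution_def poly_functional_X_power using lim by blast
  have one: "?\<psi> 1 = 1"
    using poly_functional_X_power[of _ 0] by (simp add: limit_moment_fps_nth_0)
  \<comment> \<open>The limit moments obey the moment-cumulant recursion of the series \<open>S\<close>, which fixes the cumulants.\<close>
  have "boolean_cumulant_var ?\<psi> m ?Y = fps_nth (limit_cumulant_fps a b) m" if "m > 0" for m
    by (rule boolean_cumulant_var_eqI[where \<psi> = ?\<psi> and x = ?Y, OF one _ that])
       (unfold poly_functional_X_power, rule limit_moment_recursion)
  then show "has_H_transform ?\<psi> ?Y (limit_H a b)"
    unfolding has_H_transform_def using limit_cumulant_fps_sums_limit_H[of a b]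
    by (simp del: power_Suc replicate_Suc)
qed

end
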